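(* Let $d > k \ge 1$ be integers, $A, B \in \mathbb{R}^{d\times d}$ and $\lambda>0$. Let $t_A, t_B$ be the escape-time functions of the deterministic Riccati differential equations associated with $A$ and $B$, and let $T_A, T_B$ be the mean escape times of the associated switched Riccati differential equation with Poisson switching of rate $\lambda$ (all defined in the context). Assume that there exists a constant $t_0>0$ such that $t_A(Y_0)\le t_0$ and $t_B(Y_0)\le t_0$ for all $Y_0\in\mathbb{R}^{(d-k)\times k}$. Let $f(t)=\lambda e^{-\lambda t}$ and $F(t)=\int_0^t f(\tau)\,d\tau$ for $t\ge 0$. Define real-valued functions $g_1, g_2$ on $\mathbb{R}^{(d-k)\times k}$ by $$g_1(Y)=\int_0^{t_A(Y)}\tau f(\tau)\,d\tau+t_A(Y)\bigl(1-F(t_A(Y))\bigr),\qquad g_2(Y)=\int_0^{t_B(Y)}\tau f(\tau)\,d\tau+t_B(Y)\bigl(1-F(t_B(Y))\bigr),$$ and operators $M_1, M_2$ acting on $L^\infty(\mathbb{R}^{(d-k)\times k})$ by $$(M_1T)(Y)=\int_0^{t_A(Y)}f(\tau)\,T(e^{A\tau}.Y)\,d\tau,\qquad (M_2T)(Y)=\int_0^{t_B(Y)}f(\tau)\,T(e^{B\tau}.Y)\,d\tau$$ for all $Y\in\mathbb{R}^{(d-k)\times k}$. Let $M=\begin{bmatrix} 0 & M_1 \\ M_2 & 0 \end{bmatrix}$, acting on $L^\infty(\mathbb{R}^{(d-k)\times k})^2$. Then $$\begin{bmatrix} T_A \\ T_B \end{bmatrix}=\sum_{n=0}^\infty M^n\begin{bmatrix}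 g_1 \\ g_2 \end{bmatrix}.$$
   Context: For $C\in\mathbb{R}^{d\times d}$, partition $C=\begin{bmatrix} C_{11} & C_{12} \\ C_{21} & C_{22} \end{bmatrix}$ with $C_{11}\in\mathbb{R}^{k\times k}$, $C_{12}\in\mathbb{R}^{k\times(d-k)}$, $C_{21}\in\mathbb{R}^{(d-k)\times k}$, $C_{22}\in\mathbb{R}^{(d-k)\times(d-k)}$. The Riccati differential equation (RDE) associated with $C$ is $$\frac{dY}{dt}=R_C(Y),\qquad R_C(Y):=C_{21}+C_{22}Y-YC_{11}-YC_{12}Y,\qquad Y\in\mathbb{R}^{(d-k)\times k}.$$ Its solution with $Y(0)=Y_0$ is denoted by $Y(t;Y_0)$, or by $e^{Ct}.Y_0$. Its escape time $t_C(Y_0)\in(0,\infty]$ is the first time $t>0$ at which the solution does not exist ($+\infty$ if the solution exists for all $t\ge0$). Switched RDE: let $N$ be a Poisson process of rate $\lambda>0$ and let $z$ be the $\{0,1\}$-valued process defined by $dz=(1-2z)\,dN$, $z(0)\in\{0,1\}$ (so $z$ switches between $0$ and $1$ at each jump of $N$). The switched RDE is $$dY=\bigl[z\,R_A(Y)+(1-z)\,R_B(Y)\bigr]dt .$$ Its escape time is the first time at which its solution does not exist. $T_A(Y_0)$ (resp. $T_B(Y_0)$) denotes the expected value of the escape time of the switched RDE when $Y(0)=Y_0$ and $z(0)=1$ (resp. $z(0)=0$). For a measure space $X$, $L^\infty(X)^n$ denotes the Banach space of $\mathbb{R}^n$-valued Lebesgue measurable functions $h$ on $X$ with $\|h\|=\sup_{x\in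 X}\|h(x)\|_\infty<\infty$, where $\|v\|_\infty=\max_i|v_i|$; the series is taken in $L^\infty(\mathbb{R}^{(d-k)\times k})^2$. *)

theory Defs
  imports "HOL-Probability.Probability"
begin

section \<open>Riccati differential equations\<close>

text \<open>
  The index set of size \<open>d\<close> is the sum type \<open>'k + 'm\<close>, where \<open>'k\<close> has \<open>k\<close> elements and
  \<open>'m\<close> has \<open>d - k\<close> elements; types are nonempty, so this is exactly the range \<open>d > k \<ge> 1\<close>.
  Note that \<open>real^'k^'m\<close> is the type of matrices with rows indexed by \<open>'m\<close> and columns
  indexed by \<open>'k\<close>.
\<close>

definition block11 :: "real^('k::finite + 'm::finite)^('k + 'm) \<Rightarrow> real^'k^'k" where
  "block11 C = (\<chi> i j. C $ Inl i $ Inl j)"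

definition block12 :: "real^('k::finite + 'm::finite)^('k + 'm) \<Rightarrow> real^'m^'k" where
  "block12 C = (\<chi> i j. C $ Inl i $ Inr j)"

definition block21 :: "real^('k::finite + 'm::finite)^('k + 'm) \<Rightarrow> real^'k^'m" where
  "block21 C = (\<chi> i j. C $ Inr i $ Inl j)"

definition block22 :: "real^('k::finite + 'm::finite)^('k + 'm) \<Rightarrow> real^'m^'m" where
  "block22 C = (\<chi> i j. C $ Inr i $ Inr j)"

definition riccati :: "real^('k::finite + 'm::finite)^('k + 'm) \<Rightarrow> real^'k^'m \<Rightarrow> real^'k^'m" where
  "riccati C Y = block21 C + block22 C ** Y - Y ** block11 C - Y ** block12 C ** Y"

definition rde_solution ::
  "real^('k::finite + 'm::finite)^('k + 'm) \<Rightarrow> real^'k^'m \<Rightarrow> real \<Rightarrow> (real \<Rightarrow> real^'k^'m) \<Rightarrow> bool" where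
  "rde_solution C Y0 t Y \<longleftrightarrow> Y 0 = Y0 \<and>
     (\<forall>s\<in>{0..t}. (Y has_vector_derivative riccati C (Y s)) (at s within {0..t}))"

text \<open>
  The first time at which the solution does not exist; in \<open>ereal\<close> the infimum of the empty set
  is \<open>\<infinity>\<close>, which is the value for solutions that exist for all times.
\<close>

definition rde_escape_time :: "real^('k::finite + 'm::finite)^('k + 'm) \<Rightarrow> real^'k^'m \<Rightarrow> ereal" where
  "rde_escape_time C Y0 = Inf {ereal t | t. t > 0 \<and> \<not> (\<exists>Y. rde_solution C Y0 t Y)}"

text \<open>
  The value \<open>Y(t; Y0)\<close>, also written \<open>e\<^sup>C\<^sup>t.Y0\<close>; it is only meaningful for
  \<open>0 \<le> t < rde_escape_time C Y0\<close>, where the solution exists and is unique.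
\<close>

definition rde_flow :: "real^('k::finite + 'm::finite)^('k + 'm) \<Rightarrow> real \<Rightarrow> real^'k^'m \<Rightarrow> real^'k^'m" where
  "rde_flow C t Y0 = (THE y. \<exists>Y. rde_solution C Y0 t Y \<and> Y t = y)"


section \<open>The Poisson process and the switching process\<close>

text \<open>
  Truncated subtraction is harmless in the increments below because the paths are nondecreasing.
\<close>

definition poisson_process :: "'w measure \<Rightarrow> real \<Rightarrow> (real \<Rightarrow> 'w \<Rightarrow> nat) \<Rightarrow> bool" where
  "poisson_process W lam N \<longleftrightarrow>
     prob_space W \<and> lam > 0 \<and>
     (\<forall>t\<ge>0. N t \<in> measurable W (count_space UNIV)) \<and>
     (\<forall>w\<in>space W. N 0 w = 0 \<and> mono_on {0..} (\<lambda>t. N t w) \<and>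
        (\<forall>t\<ge>0. continuous (at_right t) (\<lambda>s. N s w))) \<and>
     (\<forall>s t. 0 \<le> s \<and> s < t \<longrightarrow>
        distr W (count_space UNIV) (\<lambda>w. N t w - N s w) = measure_pmf (poisson_pmf (lam * (t - s)))) \<and>
     (\<forall>(s :: nat \<Rightarrow> real) n. 0 \<le> s 0 \<and> mono s \<longrightarrow>
        prob_space.indep_vars W (\<lambda>_. count_space UNIV) (\<lambda>i w. N (s (Suc i)) w - N (s i) w) {..<n})"

definition left_limit :: "(real \<Rightarrow> real) \<Rightarrow> real \<Rightarrow> real" where
  "left_limit h t = Lim (at_left t) h"

definition jump :: "(real \<Rightarrow> nat) \<Rightarrow> real \<Rightarrow> real" where
  "jump p t = real (p t) - left_limit (\<lambda>s. real (p s)) t"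

text \<open>
  \<open>dz = (1 - 2z) dN\<close> along one path \<open>p\<close> of \<open>N\<close>. As \<open>p\<close> is a step function, the Stieltjes
  integral of \<open>1 - 2z(s-)\<close> against \<open>p\<close> over \<open>(0, t]\<close> is a sum over the jump times of \<open>p\<close>,
  and these are finite in number because \<open>p\<close> is nondecreasing and takes values in \<open>\<nat>\<close>.
\<close>

definition switching_path :: "(real \<Rightarrow> nat) \<Rightarrow> (real \<Rightarrow> real) \<Rightarrow> bool" where
  "switching_path p z \<longleftrightarrow>
     (\<forall>t\<ge>0. z t \<in> {0, 1} \<and>
        z t = z 0 + (\<Sum>s | s \<in> {0<..t} \<and> jump p s \<noteq> 0. (1 - 2 * left_limit z s) * jump p s))"


section \<open>The switched Riccati differential equation\<close>

text \<open>
  The right-hand side jumps together with \<open>z\<close>, so the equation is read in its integrated form.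
\<close>

definition switched_solution ::
  "real^('k::finite + 'm::finite)^('k + 'm) \<Rightarrow> real^('k + 'm)^('k + 'm) \<Rightarrow> (real \<Rightarrow> real) \<Rightarrow>
   real^'k^'m \<Rightarrow> real \<Rightarrow> (real \<Rightarrow> real^'k^'m) \<Rightarrow> bool" where
  "switched_solution A B z Y0 t Y \<longleftrightarrow> continuous_on {0..t} Y \<and>
     (\<forall>s\<in>{0..t}. ((\<lambda>r. z r *\<^sub>R riccati A (Y r) + (1 - z r) *\<^sub>R riccati B (Y r))
        has_integral (Y s - Y0)) {0..s})"

definition switched_escape_time ::
  "real^('k::finite + 'm::finite)^('k + 'm) \<Rightarrow> real^('k + 'm)^('k + 'm) \<Rightarrow> (real \<Rightarrow> real) \<Rightarrow>
   real^'k^'m \<Rightarrow> ereal" where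
  "switched_escape_time A B z Y0 = Inf {ereal t | t. t > 0 \<and> \<not> (\<exists>Y. switched_solution A B z Y0 t Y)}"

definition mean_escape_time ::
  "'w measure \<Rightarrow> real^('k::finite + 'm::finite)^('k + 'm) \<Rightarrow> real^('k + 'm)^('k + 'm) \<Rightarrow>
   (real \<Rightarrow> 'w \<Rightarrow> real) \<Rightarrow> real^'k^'m \<Rightarrow> ennreal" where
  "mean_escape_time W A B z Y0 = (\<integral>\<^sup>+ w. e2ennreal (switched_escape_time A B (\<lambda>t. z t w) Y0) \<partial>W)"


section \<open>The functions \<open>g\<close> and the operators \<open>M\<close>\<close>

definition exp_density :: "real \<Rightarrow> real \<Rightarrow> real" where
  "exp_density lam t = lam * exp (- lam * t)"

definition exp_cdf :: "real \<Rightarrow> real \<Rightarrow> real" where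
  "exp_cdf lam t = (LINT s=0..ereal t|lebesgue. exp_density lam s)"

text \<open>
  The conversions by \<open>real_of_ereal\<close> are meant for finite escape times. The integrals are over
  the open interval from \<open>0\<close> to the escape time, on which the flow is defined.
\<close>

definition riccati_g :: "real \<Rightarrow> real^('k::finite + 'm::finite)^('k + 'm) \<Rightarrow> real^'k^'m \<Rightarrow> real" where
  "riccati_g lam C Y =
     (LINT s=0..rde_escape_time C Y|lebesgue. (s * exp_density lam s)) +
     real_of_ereal (rde_escape_time C Y) * (1 - exp_cdf lam (real_of_ereal (rde_escape_time C Y)))"

definition riccati_M ::
  "real \<Rightarrow> real^('k::finite + 'm::finite)^('k + 'm) \<Rightarrow> (real^'k^'m \<Rightarrow> real) \<Rightarrow> real^'k^'m \<Rightarrow> real" where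
  "riccati_M lam C T Y =
     (LINT s=0..rde_escape_time C Y|lebesgue. (exp_density lam s * T (rde_flow C s Y)))"

text \<open>Pairs of functions are functions into \<open>real^2\<close>.\<close>

definition block_M ::
  "real \<Rightarrow> real^('k::finite + 'm::finite)^('k + 'm) \<Rightarrow> real^('k + 'm)^('k + 'm) \<Rightarrow>
   (real^'k^'m \<Rightarrow> real^2) \<Rightarrow> real^'k^'m \<Rightarrow> real^2" where
  "block_M lam A B T Y =
     vector [riccati_M lam A (\<lambda>X. T X $ 2) Y, riccati_M lam B (\<lambda>X. T X $ 1) Y]"


section \<open>The space of bounded Lebesgue measurable functions\<close>

text \<open>
  The norm is a genuine supremum, not an essential one; \<open>infnorm\<close> is the maximum norm on
  \<open>real^'n\<close>.
\<close>

definition Linf :: "('a::euclidean_space \<Rightarrow> real^'n::finite) set" where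
  "Linf = {h \<in> borel_measurable lebesgue. bdd_above (range (\<lambda>x. infnorm (h x)))}"

definition Linf_norm :: "('a::euclidean_space \<Rightarrow> real^'n::finite) \<Rightarrow> real" where
  "Linf_norm h = (SUP x. infnorm (h x))"

definition Linf_sums :: "(nat \<Rightarrow> 'a::euclidean_space \<Rightarrow> real^'n::finite) \<Rightarrow> ('a \<Rightarrow> real^'n) \<Rightarrow> bool" where
  "Linf_sums u h \<longleftrightarrow> (\<forall>n. u n \<in> Linf) \<and> h \<in> Linf \<and>
     (\<lambda>n. Linf_norm (\<lambda>x. (\<Sum>i<n. u i x) - h x)) \<longlonglongrightarrow> 0"

end

theory Submission
  imports Defs
begin

text \<open>
  Let \<open>S n\<close> be the jump times of the Poisson process and \<open>X n = S (n + 1) - S n\<close>. Between jumps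
  the switched equation is one of the two deterministic ones, so along each path the escape time is
  the sum over \<open>n\<close> of the time spent in the period number \<open>n\<close>, which is the minimum of \<open>X n\<close> and
  the deterministic escape time from the current state if there was no escape before, and \<open>0\<close>
  otherwise. The length \<open>X n\<close> is exponentially distributed and independent of the past up to
  \<open>S n\<close>, so conditioning on the past one period after the other turns the expectation of the
  summand number \<open>n\<close> into the entry of \<open>M\<^sup>n (g\<^sub>1, g\<^sub>2)\<close>. Escape times are at most \<open>t\<^sub>0\<close>, so \<open>M\<close> has
  norm at most \<open>1 - exp (- \<lambda> t\<^sub>0) < 1\<close> and the series converges uniformly.

  Measurability of the escape times and of the flow comes from Radon's linearization of the
  Riccati equation.
\<close>

section \<open>The Riccati flow\<close>

text \<open>The Poisson process is given through its increments between deterministic times, while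
  the equation restarts at random jump times; most of the probabilistic work bridges this
  difference. The given paths may also be bounded or jump by two or more. Both are excluded only up
  to null sets, so the decomposition into periods holds almost everywhere and the escape time is
  measurable with respect to the completion. On the analytic side everything is read off one scalar
  function, the determinant of the matrix P in Radon's linearization. It is jointly continuous in
  time and initial value, and the escape time is its first zero; this gives existence, uniqueness
  and measurability at once. Sums and expectations are formed in \<open>ennreal\<close>, where
  interchanging them requires no integrability. Real numbers return only after the geometric bound
  has shown that every quantity is finite.\<close>

lemma bounded_bilinear_matrix_mult:
  "bounded_bilinear ((**) :: real^'n::finite^'m::finite \<Rightarrow> real^'p::finite^'n \<Rightarrow> real^'p^'m)"
  unfolding bilinear_conv_bounded_bilinear[symmetric] bilinear_def linear_iff
  by (auto simp: matrix_matrix_mult_def vec_eq_iff algebra_simps sum.distrib sum_distrib_left)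

interpretation matmul: bounded_bilinear
  "(**) :: real^'n::finite^'m::finite \<Rightarrow> real^'p::finite^'n \<Rightarrow> real^'p^'m"
  by (rule bounded_bilinear_matrix_mult)

lemma has_vector_derivative_vec_iff:
  fixes f :: "real \<Rightarrow> 'a::euclidean_space ^ 'n::finite"
  shows "(f has_vector_derivative D) (at x within S) \<longleftrightarrow>
    (\<forall>i. ((\<lambda>t. f t $ i) has_vector_derivative D $ i) (at x within S))"
proof
  assume "(f has_vector_derivative D) (at x within S)"
  then show "\<forall>i. ((\<lambda>t. f t $ i) has_vector_derivative D $ i) (at x within S)"
    by (auto intro: bounded_linear.has_vector_derivative[OF bounded_linear_vec_nth])
next
  assume *: "\<forall>i. ((\<lambda>t. f t $ i) has_vector_derivative D $ i) (at x within S)"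
  show "(f has_vector_derivative D) (at x within S)"
    unfolding has_vector_derivative_def
  proof (subst has_derivative_componentwise_within, intro ballI)
    fix b :: "'a ^ 'n" assume "b \<in> Basis"
    then obtain i u where b: "b = axis i u" "u \<in> Basis"
      by (auto simp: Basis_vec_def)
    have "((\<lambda>t. f t $ i \<bullet> u) has_vector_derivative (D $ i \<bullet> u)) (at x within S)"
      using * by (auto intro: bounded_linear.has_vector_derivative[OF bounded_linear_inner_left])
    then show "((\<lambda>x. f x \<bullet> b) has_derivative (\<lambda>x. (x *\<^sub>R D) \<bullet> b)) (at x within S)"
      by (simp add: b inner_axis has_vector_derivative_def)
  qed
qed

text \<open>Gronwall in differential form: the weighted square
  \<open>(u s \<bullet> u s) * exp (k * s)\<close> does not increase to the right of
  \<open>c\<close> for \<open>k = - 2 * K\<close> and does not decrease to the left of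
  \<open>c\<close> for \<open>k = 2 * K\<close>. The zero \<open>c\<close> may lie anywhere in the
  interval because Radon's lemma also propagates zeros backwards in time.\<close>

lemma linear_ode_zero:
  fixes u :: "real \<Rightarrow> 'a::real_inner"
  assumes der: "\<And>s. s \<in> {a..b} \<Longrightarrow> (u has_vector_derivative u' s) (at s within {a..b})"
    and bound: "\<And>s. s \<in> {a..b} \<Longrightarrow> norm (u' s) \<le> K * norm (u s)"
    and c: "c \<in> {a..b}" "u c = 0" and s: "s \<in> {a..b}"
  shows "u s = 0"
proof -
  define \<phi> where "\<phi> = (\<lambda>k s. (u s \<bullet> u s) * exp (k * s))"
  define \<psi> where "\<psi> = (\<lambda>k s. (2 * (u s \<bullet> u' s) + k * (u s \<bullet> u s)) * exp (k * s))"
  have d: "(\<phi> k has_real_derivative \<psi> k s) (at s within {a..b})" if "s \<in> {a..b}" for k s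
    unfolding \<phi>_def \<psi>_def has_real_derivative_iff_has_vector_derivative
    by (rule has_vector_derivative_eq_rhs, rule has_vector_derivative_mult,
        rule bounded_bilinear.has_vector_derivative[OF bounded_bilinear_inner der der])
      (use that in \<open>auto intro!: derivative_eq_intros simp: algebra_simps inner_commute
        simp flip: has_real_derivative_iff_has_vector_derivative\<close>)
  have cont: "continuous_on {a..b} (\<phi> k)" for k
    using d by (intro DERIV_continuous_on) auto
  have d': "(\<phi> k has_real_derivative \<psi> k s) (at s)" if "a < s" "s < b" for k s
    using d[of s k] that at_within_Icc_at[of a s b] by simp
  have ip: "\<bar>u s \<bullet> u' s\<bar> \<le> K * (u s \<bullet> u s)" if "s \<in> {a..b}" for s
  proof -
    have "\<bar>u s \<bullet> u' s\<bar> \<le> norm (u s) * norm (u' s)" by (rule Cauchy_Schwarz_ineq2)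
    also have "\<dots> \<le> norm (u s) * (K * norm (u s))"
      using bound[OF that] by (intro mult_left_mono) auto
    finally show ?thesis by (simp add: power2_norm_eq_inner[symmetric] power2_eq_square mult_ac)
  qed
  have "\<phi> k s \<le> 0" if "k = (if c \<le> s then - 2 * K else 2 * K)" for k
  proof (cases "c \<le> s")
    case True
    have "\<phi> k s \<le> \<phi> k c"
    proof (rule DERIV_nonpos_imp_decreasing_open[OF True])
      fix x assume x: "c < x" "x < s"
      then show "\<exists>y. DERIV (\<phi> k) x :> y \<and> y \<le> 0"
        using d'[of x k] ip[of x] c s True that
        by (intro exI[of _ "\<psi> k x"]) (auto simp: \<psi>_def intro!: mult_nonpos_nonneg)
    qed (use c s in \<open>auto intro!: continuous_on_subset[OF cont]\<close>)
    then show ?thesis by (simp add: \<phi>_def c)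
  next
    case False
    have "\<phi> k s \<le> \<phi> k c"
    proof (rule DERIV_nonneg_imp_increasing_open[of s c "\<phi> k"])
      show "s \<le> c" using False by simp
      fix x assume x: "s < x" "x < c"
      then show "\<exists>y. DERIV (\<phi> k) x :> y \<and> 0 \<le> y"
        using d'[of x k] ip[of x] c s False that
        by (intro exI[of _ "\<psi> k x"]) (auto simp: \<psi>_def intro!: mult_nonneg_nonneg)
    qed (use c s in \<open>auto intro!: continuous_on_subset[OF cont]\<close>)
    then show ?thesis by (simp add: \<phi>_def c)
  qed
  then have "u s \<bullet> u s \<le> 0" by (auto simp: \<phi>_def mult_le_0_iff)
  then show ?thesis by (metis inner_ge_zero inner_eq_zero_iff order_antisym)
qed

section \<open>The matrix exponential\<close>

definition matpow :: "real^'n::finite^'n \<Rightarrow> nat \<Rightarrow> real^'n^'n" where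
  "matpow C n = (((**) C) ^^ n) (mat 1)"

text \<open>The series is taken entry by entry, so that convergence and termwise differentiation
  become statements about real power series.\<close>

definition mexp :: "real^'n::finite^'n \<Rightarrow> real \<Rightarrow> real^'n^'n" where
  "mexp C t = (\<chi> i j. \<Sum>n. matpow C n $ i $ j / fact n * t ^ n)"

text \<open>Bounded bilinearity of the matrix product gives a constant \<open>K\<close> such that
  the power number \<open>n\<close> has norm at most \<open>(K * norm C) ^ n\<close> times that of
  the identity; each entry is thus dominated by an exponential series.\<close>

lemma mexp_summable:
  fixes C :: "real^'n::finite^'n"
  shows "summable (\<lambda>n. matpow C n $ i $ j / fact n * t ^ n)"
proof -
  obtain K where K: "K > 0" "\<And>(X :: real^'n^'n) (Y :: real^'n^'n). norm (X ** Y) \<le> norm X * norm Y * K"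
    using matmul.pos_bounded by blast
  have "norm (matpow C n) \<le> (K * norm C) ^ n * norm (mat 1 :: real^'n^'n)" for n
  proof (induction n)
    case (Suc n)
    have "norm (matpow C (Suc n)) \<le> norm C * norm (matpow C n) * K"
      by (simp add: matpow_def K(2)[of C])
    also have "\<dots> \<le> norm C * ((K * norm C) ^ n * norm (mat 1 :: real^'n^'n)) * K"
      using Suc K(1) by (intro mult_right_mono mult_left_mono) auto
    finally show ?case by (simp add: mult_ac)
  qed (simp add: matpow_def)
  moreover have "\<bar>matpow C n $ i $ j\<bar> \<le> norm (matpow C n)" for n
    using component_le_norm_cart[of "matpow C n $ i" j] Finite_Cartesian_Product.norm_nth_le[of "matpow C n" i]
    by linarith
  ultimately have b: "\<bar>matpow C n $ i $ j\<bar> \<le> (K * norm C) ^ n * norm (mat 1 :: real^'n^'n)" for n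
    using order_trans by blast
  show ?thesis
  proof (rule summable_comparison_test'[of "\<lambda>n. norm (mat 1 :: real^'n^'n) * (inverse (fact n) * (K * norm C * \<bar>t\<bar>) ^ n)" 0])
    show "summable (\<lambda>n. norm (mat 1 :: real^'n^'n) * (inverse (fact n) * (K * norm C * \<bar>t\<bar>) ^ n))"
      by (intro summable_mult summable_exp)
    fix n :: nat
    show "norm (matpow C n $ i $ j / fact n * t ^ n)
        \<le> norm (mat 1 :: real^'n^'n) * (inverse (fact n) * (K * norm C * \<bar>t\<bar>) ^ n)"
      using mult_right_mono[OF b[of n], of "\<bar>t\<bar>^n / fact n"]
      by (simp add: abs_mult power_abs field_simps power_mult_distrib)
  qed
qed

lemma mexp_0: "mexp C 0 = mat 1"
proof -
  have "(\<Sum>n. matpow C n $ i $ j / fact n * 0 ^ n) = mat 1 $ i $ j" for i j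
    by (subst powser_zero) (simp add: matpow_def)
  then show ?thesis by (simp add: mexp_def vec_eq_iff)
qed

lemma mexp_has_vector_derivative: "(mexp C has_vector_derivative C ** mexp C t) (at t within S)"
  unfolding has_vector_derivative_vec_iff
proof (intro allI)
  fix i j
  \<comment> \<open>\<open>diffs\<close> raises the index by one and cancels a factor of the
    factorial; the additional factor \<open>C\<close> of the next power is what remains on the
    right.\<close>
  have "(\<Sum>n. diffs (\<lambda>n. matpow C n $ i $ j / fact n) n * t ^ n)
      = (\<Sum>n. \<Sum>k\<in>UNIV. C $ i $ k * (matpow C n $ k $ j / fact n * t ^ n))"
    by (intro suminf_cong)
      (simp add: diffs_def matpow_def matrix_matrix_mult_def sum_divide_distrib sum_distrib_right mult.assoc
        sum_distrib_left divide_simps)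
  also have "\<dots> = (C ** mexp C t) $ i $ j"
    by (subst suminf_sum)
      (simp_all only: mexp_def matrix_matrix_mult_def suminf_mult[OF mexp_summable] summable_mult[OF mexp_summable] vec_lambda_beta)
  finally have "((\<lambda>t. mexp C t $ i $ j) has_real_derivative (C ** mexp C t) $ i $ j) (at t)"
    using termdiffs_strong_converges_everywhere[OF mexp_summable[of C i j], of t]
    by (simp add: mexp_def)
  then show "((\<lambda>t. mexp C t $ i $ j) has_vector_derivative (C ** mexp C t) $ i $ j) (at t within S)"
    by (simp add: has_real_derivative_iff_has_vector_derivative has_vector_derivative_at_within)
qed

text \<open>
  Cramer's rule; unlike \<open>matrix_inv\<close> this is visibly continuous in the matrix.
\<close>

definition cramer_inv :: "real^'n::finite^'n \<Rightarrow> real^'n^'n" where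
  "cramer_inv P = (\<chi> k l. det (\<chi> i j. if j = k then (if i = l then 1 else 0) else P$i$j) / det P)"

lemma cramer_inv_right: assumes "det P \<noteq> 0" shows "P ** cramer_inv P = mat 1"
proof -
  have "P *v column l (cramer_inv P) = axis l 1" for l
    by (subst cramer[OF assms]) (simp add: cramer_inv_def column_def axis_def vec_eq_iff cong: if_cong)
  then show ?thesis
    by (simp add: vec_eq_iff matrix_matrix_mult_def matrix_vector_mult_def column_def mat_def axis_def)
qed

lemma cramer_inv_left: assumes "det P \<noteq> 0" shows "cramer_inv P ** P = mat 1"
  using cramer_inv_right[OF assms] matrix_left_right_inverse by blast

lemma continuous_on_det_matrix [continuous_intros]:
  fixes f :: "'a::topological_space \<Rightarrow> real^'n::finite^'n"
  assumes "\<And>i j. continuous_on S (\<lambda>x. f x $ i $ j)"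
  shows "continuous_on S (\<lambda>x. det (f x))"
  unfolding det_def by (intro continuous_intros assms)

lemma continuous_on_cramer_inv: "continuous_on {P :: real^'n::finite^'n. det P \<noteq> 0} cramer_inv"
proof -
  have "continuous_on {P :: real^'n^'n. det P \<noteq> 0} (\<lambda>P :: real^'n^'n. det P)"
    by (intro continuous_intros)
  moreover have "continuous_on {P :: real^'n^'n. det P \<noteq> 0} (\<lambda>P :: real^'n^'n. det (\<chi> i j. if j = k then (if i = l then 1 else 0) else P$i$j))" for k l :: 'n
  proof (rule continuous_on_det_matrix)
    fix i j
    show "continuous_on {P :: real^'n^'n. det P \<noteq> 0} (\<lambda>x :: real^'n^'n. (\<chi> i j. if j = k then (if i = l then 1 else 0) else x$i$j) $ i $ j)"
      by (cases "j = k") (auto intro!: continuous_intros)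
  qed
  ultimately show ?thesis
    unfolding cramer_inv_def by (intro continuous_on_vec_lambda continuous_on_divide) auto
qed

text \<open>Where the first factor vanishes, the product rule asks only for continuity of the
  second. This lets Q P^-1 be differentiated without differentiating the inverse.\<close>

lemma has_vector_derivative_matrix_mult_zero:
  fixes F :: "real \<Rightarrow> real^'n::finite^'m::finite" and G :: "real \<Rightarrow> real^'p::finite^'n"
  assumes F: "(F has_vector_derivative F') (at r within S)" and "F r = 0"
    and G: "continuous (at r within S) G"
  shows "((\<lambda>s. F s ** G s) has_vector_derivative F' ** G r) (at r within S)"
proof -
  obtain K where K: "K > 0" "\<And>(X :: real^'n^'m) (Y :: real^'p^'n). norm (X ** Y) \<le> norm X * norm Y * K"
    using matmul.pos_bounded by blast
  have "((\<lambda>s. norm (F s - (s - r) *\<^sub>R F') / norm (s - r)) \<longlongrightarrow> 0) (at r within S)"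
    using F \<open>F r = 0\<close> by (simp add: has_vector_derivative_def has_derivative_iff_norm)
  moreover have "(G \<longlongrightarrow> G r) (at r within S)"
    using G by (simp add: continuous_within)
  ultimately have "((\<lambda>s. norm (F s - (s - r) *\<^sub>R F') / norm (s - r) * norm (G s) * K
      + norm F' * norm (G s - G r) * K) \<longlongrightarrow> 0 * norm (G r) * K + norm F' * norm (G r - G r) * K) (at r within S)"
    by (intro tendsto_intros)
  then have lim: "((\<lambda>s. norm (F s - (s - r) *\<^sub>R F') / norm (s - r) * norm (G s) * K
      + norm F' * norm (G s - G r) * K) \<longlongrightarrow> 0) (at r within S)"
    by simp
  have "norm (F s ** G s - (s - r) *\<^sub>R (F' ** G r)) / norm (s - r)
      \<le> norm (F s - (s - r) *\<^sub>R F') / norm (s - r) * norm (G s) * K + norm F' * norm (G s - G r) * K" for s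
  proof (cases "s = r")
    case False
    \<comment> \<open>The remainder splits into the linearization error of \<open>F\<close>,
      multiplied by the convergent \<open>G s\<close>, and the increment of \<open>G\<close>,
      multiplied by \<open>F'\<close>.\<close>
    have "F s ** G s - (s - r) *\<^sub>R (F' ** G r)
        = (F s - (s - r) *\<^sub>R F') ** G s + (s - r) *\<^sub>R (F' ** (G s - G r))"
      by (simp add: matmul.diff_left matmul.diff_right matmul.scaleR_left scaleR_diff_right)
    then have "norm (F s ** G s - (s - r) *\<^sub>R (F' ** G r))
        \<le> norm ((F s - (s - r) *\<^sub>R F') ** G s) + \<bar>s - r\<bar> * norm (F' ** (G s - G r))"
      by (metis norm_scaleR norm_triangle_ineq)
    also have "\<dots> \<le> norm (F s - (s - r) *\<^sub>R F') * norm (G s) * K + \<bar>s - r\<bar> * (norm F' * norm (G s - G r) * K)"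
      by (intro add_mono mult_left_mono K) auto
    finally show ?thesis using False by (simp add: field_simps)
  qed (use K in simp)
  then show ?thesis
    unfolding has_vector_derivative_def has_derivative_iff_norm
    by (intro conjI tendsto_sandwich[OF _ _ tendsto_const lim] always_eventually)
      (auto simp: \<open>F r = 0\<close> intro: bounded_linear_scaleR_left)
qed

section \<open>Block matrices and Radon's linearization\<close>

lemma UNIV_sum_split: "(\<Sum>i\<in>(UNIV :: ('k::finite + 'm::finite) set). f i) = (\<Sum>i\<in>UNIV. f (Inl i)) + (\<Sum>i\<in>UNIV. f (Inr i))"
  by (subst UNIV_Plus_UNIV[symmetric], subst sum.Plus) (auto simp: o_def)

lemma block_mult:
  fixes C X :: "real^('k::finite + 'm::finite)^('k + 'm)"
  shows "block11 (C ** X) = block11 C ** block11 X + block12 C ** block21 X"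
    "block12 (C ** X) = block11 C ** block12 X + block12 C ** block22 X"
    "block21 (C ** X) = block21 C ** block11 X + block22 C ** block21 X"
    "block22 (C ** X) = block21 C ** block12 X + block22 C ** block22 X"
  by (simp_all add: block11_def block12_def block21_def block22_def matrix_matrix_mult_def vec_eq_iff
      UNIV_sum_split)

lemma block_mat_1:
  "block11 (mat 1) = mat 1" "block12 (mat 1) = 0" "block21 (mat 1) = 0" "block22 (mat 1) = mat 1"
  by (simp_all add: block11_def block12_def block21_def block22_def mat_def vec_eq_iff)

lemma block_has_vector_derivative:
  assumes "(X has_vector_derivative X') (at t within S)"
  shows "((\<lambda>t. block11 (X t)) has_vector_derivative block11 X') (at t within S)"
    "((\<lambda>t. block12 (X t)) has_vector_derivative block12 X') (at t within S)"
    "((\<lambda>t. block21 (X t)) has_vector_derivative block21 X') (at t within S)"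
    "((\<lambda>t. block22 (X t)) has_vector_derivative block22 X') (at t within S)"
  using assms unfolding has_vector_derivative_vec_iff
  by (simp_all add: block11_def block12_def block21_def block22_def)

text \<open>
  Radon's lemma: the flow of the Riccati equation is the linear flow \<open>e\<^sup>C\<^sup>t\<close> acting on the graph
  of \<open>Y\<close>, that is, on the column span of \<open>(1, Y)\<close>, which it maps to that of \<open>(P, Q)\<close>; the
  solution is \<open>Q P\<inverse>\<close> as long as \<open>P\<close> is invertible.
\<close>

definition radonP :: "real^('k::finite + 'm::finite)^('k + 'm) \<Rightarrow> real \<Rightarrow> real^'k^'m \<Rightarrow> real^'k^'k" where
  "radonP C t Y = block11 (mexp C t) + block12 (mexp C t) ** Y"

definition radonQ :: "real^('k::finite + 'm::finite)^('k + 'm) \<Rightarrow> real \<Rightarrow> real^'k^'m \<Rightarrow> real^'k^'m" where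
  "radonQ C t Y = block21 (mexp C t) + block22 (mexp C t) ** Y"

text \<open>A total, jointly Borel replacement for \<open>rde_flow\<close>, with which it agrees
  before the escape time. The matrix P may become invertible again afterwards; the values from then
  on, like the default \<open>0\<close>, are masked wherever the function is used.\<close>

definition riccati_flow :: "real^('k::finite + 'm::finite)^('k + 'm) \<Rightarrow> real \<Rightarrow> real^'k^'m \<Rightarrow> real^'k^'m" where
  "riccati_flow C t Y = (if det (radonP C t Y) = 0 then 0 else radonQ C t Y ** cramer_inv (radonP C t Y))"

lemma radon_0: "radonP C 0 Y = mat 1" "radonQ C 0 Y = Y"
  by (simp_all add: radonP_def radonQ_def mexp_0 block_mat_1)

lemma radonP_has_vector_derivative:
  "((\<lambda>t. radonP C t Y) has_vector_derivative (block11 C ** radonP C t Y + block12 C ** radonQ C t Y)) (at t within S)"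
  unfolding radonP_def radonQ_def
  by (rule has_vector_derivative_eq_rhs,
      rule has_vector_derivative_add[OF block_has_vector_derivative(1)[OF mexp_has_vector_derivative]
        bounded_linear.has_vector_derivative[OF matmul.bounded_linear_left
          block_has_vector_derivative(2)[OF mexp_has_vector_derivative]]])
    (simp add: block_mult matrix_add_ldistrib matmul.add_left matrix_mul_assoc)

lemma radonQ_has_vector_derivative:
  "((\<lambda>t. radonQ C t Y) has_vector_derivative (block21 C ** radonP C t Y + block22 C ** radonQ C t Y)) (at t within S)"
  unfolding radonP_def radonQ_def
  by (rule has_vector_derivative_eq_rhs,
      rule has_vector_derivative_add[OF block_has_vector_derivative(3)[OF mexp_has_vector_derivative]
        bounded_linear.has_vector_derivative[OF matmul.bounded_linear_left
          block_has_vector_derivative(4)[OF mexp_has_vector_derivative]]])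
    (simp add: block_mult matrix_add_ldistrib matmul.add_left matrix_mul_assoc)

lemma continuous_on_mexp: "continuous_on S (mexp C)"
  by (rule continuous_on_vector_derivative[OF mexp_has_vector_derivative])

lemma continuous_on_block:
  assumes "continuous_on S X"
  shows "continuous_on S (\<lambda>t. block11 (X t))" "continuous_on S (\<lambda>t. block12 (X t))"
    "continuous_on S (\<lambda>t. block21 (X t))" "continuous_on S (\<lambda>t. block22 (X t))"
  unfolding block11_def block12_def block21_def block22_def
  by (intro continuous_intros assms)+

lemma continuous_on_radon:
  assumes "continuous_on S f" "continuous_on S g"
  shows "continuous_on S (\<lambda>x. radonP C (f x) (g x))" "continuous_on S (\<lambda>x. radonQ C (f x) (g x))"
  unfolding radonP_def radonQ_def
  by (intro continuous_on_add continuous_on_block matmul.continuous_on assms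
      continuous_on_compose2[OF continuous_on_mexp[of UNIV]]; simp)+

lemma continuous_on_det_radonP:
  assumes "continuous_on S f" "continuous_on S g"
  shows "continuous_on S (\<lambda>x. det (radonP C (f x) (g x)))"
  by (intro continuous_on_det_matrix continuous_on_component continuous_on_radon assms)

lemma continuous_on_cramer_inv_radonP:
  assumes "continuous_on S f" "continuous_on S g" "\<And>x. x \<in> S \<Longrightarrow> det (radonP C (f x) (g x)) \<noteq> 0"
  shows "continuous_on S (\<lambda>x. cramer_inv (radonP C (f x) (g x)))"
  by (rule continuous_on_compose2[OF continuous_on_cramer_inv]) (auto intro!: continuous_on_radon assms simp: assms(3))

lemma rde_solution_riccati_flow:
  assumes "\<And>s. s \<in> {0..t} \<Longrightarrow> det (radonP C s Y0) \<noteq> 0"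
  shows "rde_solution C Y0 t (\<lambda>s. radonQ C s Y0 ** cramer_inv (radonP C s Y0))"
proof -
  define Y where "Y = (\<lambda>s. radonQ C s Y0 ** cramer_inv (radonP C s Y0))"
  have "(Y has_vector_derivative riccati C (Y r)) (at r within {0..t})" if r: "r \<in> {0..t}" for r
  proof -
    have dr: "det (radonP C r Y0) \<noteq> 0" by (rule assms[OF r])
    \<comment> \<open>With this \<open>F\<close>,
      \<open>Y s = Y r + F s ** cramer_inv (radonP C s Y0)\<close> and \<open>F r = 0\<close>, so
      the inverse only has to be continuous at \<open>r\<close>.\<close>
    define F where "F = (\<lambda>s. radonQ C s Y0 - Y r ** radonP C s Y0)"
    define F' where "F' = (block21 C ** radonP C r Y0 + block22 C ** radonQ C r Y0)
      - Y r ** (block11 C ** radonP C r Y0 + block12 C ** radonQ C r Y0)"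
    have F: "(F has_vector_derivative F') (at r within {0..t})"
      unfolding F_def F'_def
      by (intro has_vector_derivative_diff radonQ_has_vector_derivative radonP_has_vector_derivative
          bounded_linear.has_vector_derivative[OF matmul.bounded_linear_right])
    have F0: "F r = 0"
      by (simp add: F_def Y_def flip: matrix_mul_assoc) (simp add: cramer_inv_left[OF dr])
    have "continuous_on {0..t} (\<lambda>s. cramer_inv (radonP C s Y0))"
      by (intro continuous_on_cramer_inv_radonP continuous_intros assms)
    then have "continuous (at r within {0..t}) (\<lambda>s. cramer_inv (radonP C s Y0))"
      using r by (simp add: continuous_on_eq_continuous_within)
    from has_vector_derivative_add[OF has_vector_derivative_const has_vector_derivative_matrix_mult_zero[OF F F0 this], of "Y r"]
    have "((\<lambda>s. Y r + F s ** cramer_inv (radonP C s Y0)) has_vector_derivative F' ** cramer_inv (radonP C r Y0)) (at r within {0..t})"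
      by simp
    moreover have Ys: "Y r + F s ** cramer_inv (radonP C s Y0) = Y s" if "s \<in> {0..t}" for s
      using cramer_inv_right[OF assms[OF that]]
      by (simp add: F_def Y_def[of] matmul.diff_left flip: matrix_mul_assoc)
    moreover have "F' ** cramer_inv (radonP C r Y0) = riccati C (Y r)"
      using cramer_inv_right[OF dr]
      by (simp add: F'_def riccati_def Y_def matmul.diff_left matmul.add_left matrix_add_ldistrib flip: matrix_mul_assoc)
    ultimately have "((\<lambda>s. Y r + F s ** cramer_inv (radonP C s Y0)) has_vector_derivative riccati C (Y r)) (at r within {0..t})"
      by simp
    then show ?thesis
      by (rule has_vector_derivative_transform[OF r, rotated]) (simp add: Ys)
  qed
  then show ?thesis
    unfolding rde_solution_def Y_def[symmetric]
    using cramer_inv_right[of "mat 1 :: real^'a^'a"] by (simp add: Y_def radon_0)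
qed

text \<open>The converse of the construction, and with it uniqueness. A given solution yields two
  linear equations: one forces Q = Y P, the other keeps P invertible.\<close>

lemma rde_solution_radon:
  fixes C :: "real^('k::finite + 'm::finite)^('k + 'm)"
  assumes Y: "rde_solution C Y0 t Y" and s: "s \<in> {0..t}"
  shows "det (radonP C s Y0) \<noteq> 0" "Y s = radonQ C s Y0 ** cramer_inv (radonP C s Y0)"
proof -
  define P where "P = (\<lambda>s. radonP C s Y0)"
  define Q where "Q = (\<lambda>s. radonQ C s Y0)"
  have dY: "(Y has_vector_derivative riccati C (Y s)) (at s within {0..t})" if "s \<in> {0..t}" for s
    using Y that by (auto simp: rde_solution_def)
  have dP: "(P has_vector_derivative block11 C ** P s + block12 C ** Q s) (at s within S)" for s S
    unfolding P_def Q_def by (rule radonP_has_vector_derivative)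
  have dQ: "(Q has_vector_derivative block21 C ** P s + block22 C ** Q s) (at s within S)" for s S
    unfolding P_def Q_def by (rule radonQ_has_vector_derivative)
  have contY: "continuous_on {0..t} Y"
    by (rule continuous_on_vector_derivative[OF dY])
  obtain K1 where K1: "K1 > 0" "\<And>(X :: real^'m^'m) (Y :: real^'k^'m). norm (X ** Y) \<le> norm X * norm Y * K1"
    using matmul.pos_bounded by blast
  have "compact ((\<lambda>s. block22 C - Y s ** block12 C) ` {0..t})"
    by (intro compact_continuous_image continuous_intros matmul.continuous_on contY) auto
  then obtain B1 where B1: "\<And>s. s \<in> {0..t} \<Longrightarrow> norm (block22 C - Y s ** block12 C) \<le> B1"
    using compact_imp_bounded[of "(\<lambda>s. block22 C - Y s ** block12 C) ` {0..t}"] unfolding bounded_iff by blast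
  \<comment> \<open>The terms quadratic in \<open>Y\<close> combine: Q - Y P solves a linear
    equation with coefficient \<open>block22 C - Y s ** block12 C\<close>, which is bounded on the
    compact interval, and it vanishes at time \<open>0\<close>.\<close>
  have QYP: "Q s - Y s ** P s = 0" if "s \<in> {0..t}" for s
  proof (rule linear_ode_zero[where u = "\<lambda>s. Q s - Y s ** P s" and c = 0 and K = "B1 * K1" and a = 0 and b = t])
    fix s assume s: "s \<in> {0..t}"
    show "((\<lambda>s. Q s - Y s ** P s) has_vector_derivative (block22 C - Y s ** block12 C) ** (Q s - Y s ** P s)) (at s within {0..t})"
      by (rule has_vector_derivative_eq_rhs,
          rule has_vector_derivative_diff[OF dQ matmul.has_vector_derivative[OF dY[OF s] dP]])
        (simp add: riccati_def matmul.diff_left matmul.diff_right matmul.add_left matrix_add_ldistrib matrix_mul_assoc)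
    show "norm ((block22 C - Y s ** block12 C) ** (Q s - Y s ** P s)) \<le> B1 * K1 * norm (Q s - Y s ** P s)"
      using order_trans[OF K1(2) mult_right_mono[OF mult_right_mono[OF B1[OF s] norm_ge_zero]]] K1(1)
      by (simp add: mult_ac)
  next
    show "Q 0 - Y 0 ** P 0 = 0"
      using Y by (simp add: P_def Q_def radon_0 rde_solution_def)
  qed (use that in auto)
  then have QY: "Q s = Y s ** P s" if "s \<in> {0..t}" for s using that by simp
  show det: "det (radonP C s Y0) \<noteq> 0"
  proof
    assume "det (radonP C s Y0) = 0"
    then obtain v where v: "v \<noteq> 0" "P s *v v = 0"
      using invertible_det_nz[of "P s"] matrix_left_invertible_ker[of "P s"]
      by (auto simp: P_def invertible_left_inverse)
    have bb: "bounded_bilinear ((*v) :: real^'k^'k \<Rightarrow> real^'k \<Rightarrow> real^'k)"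
      unfolding bilinear_conv_bounded_bilinear[symmetric] bilinear_def linear_iff
      by (auto simp: matrix_vector_mult_def vec_eq_iff algebra_simps sum.distrib sum_distrib_left)
    then obtain K2 where K2: "K2 > 0" "\<And>(X :: real^'k^'k) (x :: real^'k). norm (X *v x) \<le> norm X * norm x * K2"
      using bounded_bilinear.pos_bounded by blast
    have "compact ((\<lambda>s. block11 C + block12 C ** Y s) ` {0..t})"
      by (intro compact_continuous_image continuous_intros matmul.continuous_on contY) auto
    then obtain B2 where B2: "\<And>s. s \<in> {0..t} \<Longrightarrow> norm (block11 C + block12 C ** Y s) \<le> B2"
      using compact_imp_bounded[of "(\<lambda>s. block11 C + block12 C ** Y s) ` {0..t}"] unfolding bounded_iff by blast
    \<comment> \<open>Since Q = Y P, the equation for P is linear in P alone, so a kernel vector at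
      time \<open>s\<close> is transported back to time \<open>0\<close>, where P is the
      identity.\<close>
    have "P 0 *v v = 0"
    proof (rule linear_ode_zero[where u = "\<lambda>s. P s *v v" and c = s and K = "B2 * K2" and a = 0 and b = t])
      fix s assume s: "s \<in> {0..t}"
      have "((\<lambda>s. P s *v v) has_vector_derivative (block11 C ** P s + block12 C ** Q s) *v v) (at s within {0..t})"
        by (intro bounded_linear.has_vector_derivative[OF bounded_bilinear.bounded_linear_left[OF bb]] dP)
      also have "(block11 C ** P s + block12 C ** Q s) *v v = (block11 C + block12 C ** Y s) *v (P s *v v)"
        by (simp add: QY[OF s] matrix_vector_mul_assoc matmul.add_left matrix_mul_assoc)
      finally show "((\<lambda>s. P s *v v) has_vector_derivative (block11 C + block12 C ** Y s) *v (P s *v v)) (at s within {0..t})" .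
      show "norm ((block11 C + block12 C ** Y s) *v (P s *v v)) \<le> B2 * K2 * norm (P s *v v)"
        using order_trans[OF K2(2) mult_right_mono[OF mult_right_mono[OF B2[OF s] norm_ge_zero]]] K2(1)
        by (simp add: mult_ac)
    qed (use s v in auto)
    with v show False by (simp add: P_def radon_0)
  qed
  show "Y s = radonQ C s Y0 ** cramer_inv (radonP C s Y0)"
    using QY[OF s] cramer_inv_right[OF det] by (simp add: P_def Q_def flip: matrix_mul_assoc)
qed

lemma rde_solution_eq_riccati_flow:
  assumes "rde_solution C Y0 t Y" "s \<in> {0..t}"
  shows "Y s = riccati_flow C s Y0"
  using rde_solution_radon[OF assms] by (simp add: riccati_flow_def)

lemma rde_solvable_iff_det:
  "(\<exists>Y. rde_solution C Y0 t Y) \<longleftrightarrow> (\<forall>s\<in>{0..t}. det (radonP C s Y0) \<noteq> 0)"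
  using rde_solution_radon(1) rde_solution_riccati_flow by blast

section \<open>The escape time as the first zero of a determinant\<close>

lemma det_radonP_open:
  assumes "0 \<le> t" "\<forall>s\<in>{0..t}. det (radonP C s Y0) \<noteq> 0"
  shows "\<exists>e>0. \<forall>s\<in>{0..t+e}. det (radonP C s Y0) \<noteq> 0"
proof -
  have "continuous_on UNIV (\<lambda>s. det (radonP C s Y0))"
    by (intro continuous_on_det_radonP continuous_intros)
  then have "isCont (\<lambda>s. det (radonP C s Y0)) t"
    by (simp add: continuous_on_eq_continuous_at)
  moreover have "det (radonP C t Y0) \<noteq> 0" using assms by auto
  ultimately obtain e where e: "e > 0" "\<And>s. dist t s < e \<Longrightarrow> det (radonP C s Y0) \<noteq> 0"
    using continuous_at_avoid[of t "\<lambda>s. det (radonP C s Y0)" 0] by blast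
  show ?thesis
  proof (intro exI[of _ "e/2"] conjI ballI)
    fix s assume "s \<in> {0..t+e/2}"
    then show "det (radonP C s Y0) \<noteq> 0"
      using assms(2) e(1) e(2)[of s] by (cases "s \<le> t") (auto simp: dist_real_def)
  qed (use e in auto)
qed

text \<open>Nonvanishing of the determinant is an open condition, so a solution on the closed
  interval up to \<open>t\<close> extends beyond \<open>t\<close>. This makes the inequality strict:
  at a finite escape time itself there is no solution. Time \<open>0\<close>, over which the infimum
  does not range, is covered because P is the identity there.\<close>

lemma less_rde_escape_time_iff_det:
  assumes "0 \<le> t"
  shows "ereal t < rde_escape_time C Y0 \<longleftrightarrow> (\<forall>s\<in>{0..t}. det (radonP C s Y0) \<noteq> 0)"
proof
  assume less: "ereal t < rde_escape_time C Y0"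
  have "\<exists>Y. rde_solution C Y0 t Y" 
  proof (cases "t = 0")
    case True
    then show ?thesis by (subst rde_solvable_iff_det) (auto simp: radon_0)
  next
    case False
    then show ?thesis
      using less assms Inf_lower[of "ereal t" "{ereal t |t. t > 0 \<and> \<not> (\<exists>Y. rde_solution C Y0 t Y)}"]
      unfolding rde_escape_time_def by fastforce
  qed
  then show "\<forall>s\<in>{0..t}. det (radonP C s Y0) \<noteq> 0" by (simp add: rde_solvable_iff_det)
next
  assume "\<forall>s\<in>{0..t}. det (radonP C s Y0) \<noteq> 0"
  from det_radonP_open[OF assms this] obtain e where
    e: "e > 0" "\<forall>s\<in>{0..t+e}. det (radonP C s Y0) \<noteq> 0" by blast
  have "ereal (t + e) \<le> rde_escape_time C Y0"
    unfolding rde_escape_time_def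
  proof (rule Inf_greatest, clarify)
    fix u assume "0 < u" and no: "\<nexists>Y. rde_solution C Y0 u Y"
    with e(2) have "\<not> u \<le> t + e" unfolding rde_solvable_iff_det by auto
    then show "ereal (t + e) \<le> ereal u" by simp
  qed
  moreover have "ereal t < ereal (t + e)" using e by simp
  ultimately show "ereal t < rde_escape_time C Y0" by (rule less_le_trans[rotated])
qed

lemma rde_solvable_iff:
  assumes "0 \<le> t"
  shows "(\<exists>Y. rde_solution C Y0 t Y) \<longleftrightarrow> ereal t < rde_escape_time C Y0"
  using less_rde_escape_time_iff_det[OF assms] rde_solvable_iff_det by blast

lemma rde_escape_time_pos: "0 < rde_escape_time C Y0"
  using less_rde_escape_time_iff_det[of 0 C Y0] by (simp add: radon_0 zero_ereal_def)

lemma rde_flow_eq: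
  assumes "0 \<le> t" "ereal t < rde_escape_time C Y0"
  shows "rde_flow C t Y0 = riccati_flow C t Y0"
  unfolding rde_flow_def
proof (rule the_equality)
  show "\<exists>Y. rde_solution C Y0 t Y \<and> Y t = riccati_flow C t Y0"
    using assms rde_solvable_iff rde_solution_eq_riccati_flow[of C Y0 t _ t] by fastforce
qed (use assms in \<open>auto dest!: rde_solution_eq_riccati_flow[of C Y0 t _ t]\<close>)

lemma rde_flow_solution:
  assumes "0 \<le> t" "ereal t < rde_escape_time C Y0"
  shows "rde_solution C Y0 t (\<lambda>s. riccati_flow C s Y0)"
proof -
  obtain Y where Y: "rde_solution C Y0 t Y" using assms rde_solvable_iff by blast
  have eq: "Y s = riccati_flow C s Y0" if "s \<in> {0..t}" for s
    using rde_solution_eq_riccati_flow[OF Y that] .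
  show ?thesis
    unfolding rde_solution_def
  proof (intro conjI ballI)
    show "riccati_flow C 0 Y0 = Y0" using Y eq[of 0] assms by (simp add: rde_solution_def)
    fix s assume s: "s \<in> {0..t}"
    then have "(Y has_vector_derivative riccati C (riccati_flow C s Y0)) (at s within {0..t})"
      using Y eq[OF s] s unfolding rde_solution_def by metis
    then show "((\<lambda>s. riccati_flow C s Y0) has_vector_derivative riccati C (riccati_flow C s Y0)) (at s within {0..t})"
      by (rule has_vector_derivative_transform[OF s, rotated]) (simp add: eq)
  qed
qed

text \<open>For \<open>0 \<le> t\<close> the complement is the projection, along the compact
  interval \<open>{0..t}\<close>, of the closed zero set of a jointly continuous function. The
  escape time is therefore lower semicontinuous in the initial value, hence Borel.\<close>

lemma open_less_rde_escape_time:
  fixes C :: "real^('k::finite + 'm::finite)^('k + 'm)"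
  shows "open {Y. ereal t < rde_escape_time C Y}"
proof (cases "t < 0")
  case True
  then have "ereal t < rde_escape_time C Y" for Y :: "real^'k^'m"
    using rde_escape_time_pos[of C Y] True less_trans[of "ereal t" 0] by auto
  then show ?thesis by simp
next
  case False
  define U where "U = {Y. \<exists>s. s \<in> {0..t} \<and> (s, Y) \<in> {z :: real \<times> (real^'k^'m). det (radonP C (fst z) (snd z)) = 0}}"
  have "continuous_on UNIV (\<lambda>z :: real \<times> (real^'k^'m). det (radonP C (fst z) (snd z)))"
    by (intro continuous_on_det_radonP continuous_intros)
  then have "closed {z :: real \<times> (real^'k^'m). det (radonP C (fst z) (snd z)) = 0}"
    by (intro closed_Collect_eq continuous_on_const)
  then have "closed U"
    unfolding U_def by (intro closed_compact_projection compact_Icc)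
  moreover have "{Y. ereal t < rde_escape_time C Y} = - U"
    using False by (auto simp: U_def less_rde_escape_time_iff_det)
  ultimately show ?thesis by (simp add: open_Compl)
qed

lemma borel_measurable_rde_escape_time [measurable]: "rde_escape_time C \<in> borel_measurable borel"
proof -
  have "{Y \<in> space borel. a < rde_escape_time C Y} \<in> sets borel" for a
  proof (cases a)
    case (real r)
    then show ?thesis using borel_open[OF open_less_rde_escape_time[of r C]] by simp
  next
    case MInf
    have "-\<infinity> < rde_escape_time C Y" for Y
      using rde_escape_time_pos[of C Y] by (rule less_trans[rotated]) simp
    then have "{Y \<in> space borel. a < rde_escape_time C Y} = UNIV"
      unfolding MInf by simp
    then show ?thesis by simp
  qed simp
  then show ?thesis by (rule borel_measurableI_greater)
qed

lemma borel_measurable_riccati_flow [measurable]: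
  fixes C :: "real^('k::finite + 'm::finite)^('k + 'm)"
  shows "(\<lambda>z. riccati_flow C (fst z) (snd z)) \<in> borel_measurable borel"
proof -
  define U where "U = {z :: real \<times> (real^'k^'m). det (radonP C (fst z) (snd z)) \<noteq> 0}"
  have c: "continuous_on UNIV (\<lambda>z :: real \<times> (real^'k^'m). det (radonP C (fst z) (snd z)))"
    by (intro continuous_on_det_radonP continuous_intros)
  then have U: "U \<in> sets borel"
    unfolding U_def by (intro borel_open open_Collect_neq continuous_on_const)
  have "continuous_on U (\<lambda>z. radonQ C (fst z) (snd z) ** cramer_inv (radonP C (fst z) (snd z)))"
    by (intro matmul.continuous_on continuous_on_radon continuous_on_cramer_inv_radonP continuous_intros)
      (auto simp: U_def)
  from borel_measurable_continuous_on_indicator[OF U this]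
  show ?thesis
    by (rule measurable_cong[THEN iffD1, rotated]) (auto simp: riccati_flow_def U_def indicator_def)
qed

section \<open>The switched equation along one path\<close>

lemma continuous_on_riccati: "continuous_on S Y \<Longrightarrow> continuous_on S (\<lambda>s. riccati C (Y s))"
  unfolding riccati_def by (intro continuous_intros matmul.continuous_on)

text \<open>The interval may end at the switch \<open>x\<close> itself, where \<open>z\<close> can
  already have its new value; a single point does not affect the integral.\<close>

lemma switched_integrand_eq:
  fixes z :: "real \<Rightarrow> real"
  assumes "\<And>r. 0 \<le> r \<Longrightarrow> r < x \<Longrightarrow> z r = of_bool c" "s \<le> x"
  shows "((\<lambda>r. z r *\<^sub>R riccati A (Y r) + (1 - z r) *\<^sub>R riccati B (Y r)) has_integral I) {0..s}
    \<longleftrightarrow> ((\<lambda>r. riccati (if c then A else B) (Y r)) has_integral I) {0..s}"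
  by (rule has_integral_spike_finite_eq[of "{x}"]) (use assms in auto)

text \<open>Up to the next switch the integrand may be replaced by one that is continuous along
  \<open>Y\<close>, so the two directions are the two halves of the fundamental theorem of
  calculus.\<close>

lemma switched_solution_iff_rde_solution:
  fixes z :: "real \<Rightarrow> real"
  assumes z: "\<And>r. 0 \<le> r \<Longrightarrow> r < x \<Longrightarrow> z r = of_bool c" and t: "0 \<le> t" "t \<le> x"
  shows "switched_solution A B z Y0 t Y \<longleftrightarrow> rde_solution (if c then A else B) Y0 t Y"
proof -
  define C where "C = (if c then A else B)"
  have int: "((\<lambda>r. z r *\<^sub>R riccati A (Y r) + (1 - z r) *\<^sub>R riccati B (Y r)) has_integral I) {0..s}
    \<longleftrightarrow> ((\<lambda>r. riccati C (Y r)) has_integral I) {0..s}" if "s \<in> {0..t}" for s I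
    unfolding C_def using that t by (intro switched_integrand_eq[OF z]) auto
  have "switched_solution A B z Y0 t Y \<longleftrightarrow> rde_solution C Y0 t Y"
  proof
    assume "switched_solution A B z Y0 t Y"
    then have cont: "continuous_on {0..t} Y"
      and I: "\<And>s. s \<in> {0..t} \<Longrightarrow> ((\<lambda>r. riccati C (Y r)) has_integral (Y s - Y0)) {0..s}"
      unfolding switched_solution_def using int by blast+
    have Y: "Y s = Y0 + integral {0..s} (\<lambda>r. riccati C (Y r))" if "s \<in> {0..t}" for s
      using integral_unique[OF I[OF that]] by simp
    show "rde_solution C Y0 t Y"
      unfolding rde_solution_def
    proof (intro conjI ballI)
      show "Y 0 = Y0" using Y[of 0] t by simp
      fix s assume s: "s \<in> {0..t}"
      have "((\<lambda>s. Y0 + integral {0..s} (\<lambda>r. riccati C (Y r))) has_vector_derivative 0 + riccati C (Y s)) (at s within {0..t})"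
        by (intro has_vector_derivative_add has_vector_derivative_const
            integral_has_vector_derivative continuous_on_riccati cont s)
      then show "(Y has_vector_derivative riccati C (Y s)) (at s within {0..t})"
        using has_vector_derivative_transform[OF s Y] by auto
    qed
  next
    assume *: "rde_solution C Y0 t Y"
    then have Y0: "Y 0 = Y0" and der: "\<And>s. s \<in> {0..t} \<Longrightarrow> (Y has_vector_derivative riccati C (Y s)) (at s within {0..t})"
      by (auto simp: rde_solution_def)
    show "switched_solution A B z Y0 t Y"
      unfolding switched_solution_def
    proof (intro conjI ballI)
      show "continuous_on {0..t} Y" by (rule continuous_on_vector_derivative[OF der])
      fix s assume s: "s \<in> {0..t}"
      have "((\<lambda>r. riccati C (Y r)) has_integral (Y s - Y 0)) {0..s}"
        using s by (intro fundamental_theorem_of_calculus has_vector_derivative_within_subset[OF der]) auto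
      then show "((\<lambda>r. z r *\<^sub>R riccati A (Y r) + (1 - z r) *\<^sub>R riccati B (Y r)) has_integral (Y s - Y0)) {0..s}"
        using int[OF s] Y0 by simp
    qed
  qed
  then show ?thesis by (simp add: C_def)
qed

section \<open>Restarting the switched equation after a period\<close>

lemma has_integral_shift_Icc:
  fixes f :: "real \<Rightarrow> 'a::banach"
  shows "((\<lambda>r. f (r + x)) has_integral I) {a..b} \<longleftrightarrow> (f has_integral I) {a + x..b + x}"
proof -
  have 1: "((\<lambda>r. g (r + y)) has_integral I) {u..v}" if "(g has_integral I) {u+y..v+y}" for g :: "real \<Rightarrow> 'a" and u v y
  proof -
    have eq: "(\<lambda>w. inverse 1 *\<^sub>R w + - (inverse 1 *\<^sub>R y)) ` {u + y..v + y} = {u..v}"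
      by (auto simp: image_iff intro!: bexI[of _ "_ + y"])
    show ?thesis
      using has_integral_affinity[of g I "u+y" "v+y" 1 y] that by (simp add: eq)
  qed
  show ?thesis
    using 1[of f a x b] 1[of "\<lambda>r. f (r + x)" "a+x" "-x" "b+x"] by auto
qed

text \<open>Cutting a solution at \<open>x\<close> gives a solution of the shifted problem, and
  gluing reverses this. Uniqueness for the deterministic equation identifies the state at
  \<open>x\<close> with the flow.\<close>

lemma switched_solvable_shift:
  fixes z :: "real \<Rightarrow> real" and Y0 :: "real^'k::finite^'m::finite"
    and A B :: "real^('k + 'm)^('k + 'm)"
  assumes z: "\<And>r. 0 \<le> r \<Longrightarrow> r < x \<Longrightarrow> z r = of_bool c" and x: "0 < x" "x < t"
  defines "C \<equiv> if c then A else B"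
  shows "(\<exists>Y. switched_solution A B z Y0 t Y) \<longleftrightarrow> ereal x < rde_escape_time C Y0 \<and>
    (\<exists>Y. switched_solution A B (\<lambda>r. z (r + x)) (riccati_flow C x Y0) (t - x) Y)"
proof -
  define f where "f = (\<lambda>(Y :: real \<Rightarrow> real^'k^'m) r. z r *\<^sub>R riccati A (Y r) + (1 - z r) *\<^sub>R riccati B (Y r))"
  have iff: "switched_solution A B z Y0 x Y \<longleftrightarrow> rde_solution C Y0 x Y" for Y
    unfolding C_def by (rule switched_solution_iff_rde_solution[OF z]) (use x in auto)
  show ?thesis
  proof safe
    fix Y assume Y: "switched_solution A B z Y0 t Y"
    then have cont: "continuous_on {0..t} Y" and I: "\<And>s. s \<in> {0..t} \<Longrightarrow> (f Y has_integral (Y s - Y0)) {0..s}"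
      by (auto simp: switched_solution_def f_def)
    have "switched_solution A B z Y0 x Y"
      unfolding switched_solution_def using I x by (auto simp: f_def intro: continuous_on_subset[OF cont])
    then have rx: "rde_solution C Y0 x Y" by (simp add: iff)
    then show "ereal x < rde_escape_time C Y0"
      using rde_solvable_iff[of x C Y0] x by auto
    have Yx: "Y x = riccati_flow C x Y0"
      using rde_solution_eq_riccati_flow[OF rx] x by auto
    have "switched_solution A B (\<lambda>r. z (r + x)) (riccati_flow C x Y0) (t - x) (\<lambda>r. Y (r + x))"
      unfolding switched_solution_def
    proof (intro conjI ballI)
      show "continuous_on {0..t - x} (\<lambda>r. Y (r + x))"
        by (rule continuous_on_compose2[OF cont]) (use x in \<open>auto intro!: continuous_intros\<close>)
      fix s assume s: "s \<in> {0..t - x}"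
      have sx: "s + x \<in> {0..t}" "x \<in> {0..t}" using s x by auto
      have "f Y integrable_on {x..s+x}"
        by (rule integrable_subinterval_real[OF has_integral_integrable[OF I[OF sx(1)]]]) (use s x in auto)
      then obtain J where J: "(f Y has_integral J) {x..s+x}" by blast
      have "(f Y has_integral (Y x - Y0) + J) {0..s+x}"
        by (rule has_integral_combine[OF _ _ I[OF sx(2)] J]) (use s x in auto)
      then have "J = Y (s + x) - Y x"
        using has_integral_unique[OF I[OF sx(1)]] by (auto simp: algebra_simps)
      then have "((\<lambda>r. f Y (r + x)) has_integral Y (s + x) - riccati_flow C x Y0) {0..s}"
        using J by (subst has_integral_shift_Icc) (simp add: Yx)
      then show "((\<lambda>r. z (r + x) *\<^sub>R riccati A (Y (r + x)) + (1 - z (r + x)) *\<^sub>R riccati B (Y (r + x)))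
        has_integral Y (s + x) - riccati_flow C x Y0) {0..s}"
        by (simp add: f_def)
    qed
    then show "\<exists>Y. switched_solution A B (\<lambda>r. z (r + x)) (riccati_flow C x Y0) (t - x) Y" by blast
  next
    fix Y assume lt: "ereal x < rde_escape_time C Y0"
      and Y: "switched_solution A B (\<lambda>r. z (r + x)) (riccati_flow C x Y0) (t - x) Y"
    \<comment> \<open>The two pieces fit together at \<open>x\<close>, because the integrated
      equation at time \<open>0\<close> fixes the initial value of \<open>Y\<close>.\<close>
    define V where "V = (\<lambda>r. if r \<le> x then riccati_flow C r Y0 else Y (r - x))"
    have cont: "continuous_on {0..t - x} Y"
      and I: "\<And>s. s \<in> {0..t - x} \<Longrightarrow> ((\<lambda>r. z (r + x) *\<^sub>R riccati A (Y r) + (1 - z (r + x)) *\<^sub>R riccati B (Y r))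
        has_integral Y s - riccati_flow C x Y0) {0..s}"
      using Y by (auto simp: switched_solution_def)
    have Y00: "Y 0 = riccati_flow C x Y0" using has_integral_unique[of _ "Y 0 - riccati_flow C x Y0" "{0}" 0] I[of 0] x by (simp add: has_integral_refl)
    have "rde_solution C Y0 x (\<lambda>s. riccati_flow C s Y0)"
      by (rule rde_flow_solution) (use x lt in auto)
    then have "switched_solution A B z Y0 x (\<lambda>s. riccati_flow C s Y0)" by (simp add: iff)
    then have cont1: "continuous_on {0..x} (\<lambda>s. riccati_flow C s Y0)"
      and I1: "\<And>s. s \<in> {0..x} \<Longrightarrow> (f (\<lambda>s. riccati_flow C s Y0) has_integral (riccati_flow C s Y0 - Y0)) {0..s}"
      by (auto simp: switched_solution_def f_def)
    have I1': "(f V has_integral (V s - Y0)) {0..s}" if "s \<in> {0..x}" for s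
    proof -
      have "(f V has_integral (riccati_flow C s Y0 - Y0)) {0..s}"
        by (rule has_integral_eq[OF _ I1[OF that]]) (use that in \<open>auto simp: f_def V_def\<close>)
      then show ?thesis using that by (simp add: V_def)
    qed
    have "switched_solution A B z Y0 t V"
      unfolding switched_solution_def
    proof (intro conjI ballI)
      have "continuous_on ({0..x} \<union> {x..t}) V"
        unfolding V_def
      proof (rule continuous_on_cases)
        show "continuous_on {x..t} (\<lambda>r. Y (r - x))"
          by (rule continuous_on_compose2[OF cont]) (auto intro!: continuous_intros)
      qed (use cont1 Y00 in auto)
      moreover have "{0..x} \<union> {x..t} = {0..t}" using x by auto
      ultimately show "continuous_on {0..t} V" by simp
      fix s assume s: "s \<in> {0..t}"
      have "(f V has_integral (V s - Y0)) {0..s}"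
      proof (cases "s \<le> x")
        case True
        then show ?thesis using I1' s by auto
      next
        case False
        have "((\<lambda>r. f V (r + x)) has_integral Y (s - x) - riccati_flow C x Y0) {0..s - x}"
          by (rule has_integral_eq[OF _ I]) (use s False Y00 in \<open>auto simp: f_def V_def\<close>)
        then have "(f V has_integral V s - V x) {x..s}"
          using False has_integral_shift_Icc[of "f V" x _ 0 "s - x"] by (simp add: V_def)
        from has_integral_combine[OF _ _ I1'[of x] this] show ?thesis using x False by simp
      qed
      then show "((\<lambda>r. z r *\<^sub>R riccati A (V r) + (1 - z r) *\<^sub>R riccati B (V r)) has_integral (V s - Y0)) {0..s}"
        by (simp add: f_def)
    qed
    then show "\<exists>Y. switched_solution A B z Y0 t Y" by blast
  qed
qed

lemma Inf_ereal_translate: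
  fixes x :: real and S :: "ereal set"
  shows "Inf ((+) (ereal x) ` S) = ereal x + Inf S"
proof (rule antisym)
  have "Inf ((+) (ereal x) ` S) - ereal x \<le> s" if "s \<in> S" for s
    using Inf_lower[of "ereal x + s" "(+) (ereal x) ` S"] that
    by (simp add: ereal_minus_le add.commute)
  then have "Inf ((+) (ereal x) ` S) - ereal x \<le> Inf S" by (rule Inf_greatest)
  then show "Inf ((+) (ereal x) ` S) \<le> ereal x + Inf S"
    by (simp add: ereal_minus_le add.commute)
qed (auto intro!: Inf_greatest add_left_mono Inf_lower)

text \<open>A renewal identity for one period, obtained by comparing the sets of times without a
  solution. If the flow survives until \<open>x\<close>, this set is a translate by \<open>x\<close>
  of the one for the restarted problem; otherwise it is the half-line from the deterministic escape
  time on.\<close>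

lemma switched_escape_time_shift:
  fixes z :: "real \<Rightarrow> real" and Y0 :: "real^'k::finite^'m::finite"
    and A B :: "real^('k + 'm)^('k + 'm)"
  assumes z: "\<And>r. 0 \<le> r \<Longrightarrow> r < x \<Longrightarrow> z r = of_bool c" and x: "0 < x"
  defines "C \<equiv> if c then A else B"
  shows "switched_escape_time A B z Y0 = (if ereal x < rde_escape_time C Y0
    then ereal x + switched_escape_time A B (\<lambda>r. z (r + x)) (riccati_flow C x Y0)
    else rde_escape_time C Y0)"
proof -
  have small: "(\<exists>Y. switched_solution A B z Y0 t Y) \<longleftrightarrow> ereal t < rde_escape_time C Y0" if "0 < t" "t \<le> x" for t
    using switched_solution_iff_rde_solution[of x z c t A B Y0] z that rde_solvable_iff[of t C Y0]
    by (simp add: C_def)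
  note large = switched_solvable_shift[of x z c _ A B Y0, OF z x, folded C_def]
  show ?thesis
  proof (cases "ereal x < rde_escape_time C Y0")
    case True
    have "{ereal t |t. 0 < t \<and> \<not> (\<exists>Y. switched_solution A B z Y0 t Y)}
      = (+) (ereal x) ` {ereal t |t. 0 < t \<and> \<not> (\<exists>Y. switched_solution A B (\<lambda>r. z (r + x)) (riccati_flow C x Y0) t Y)}"
      (is "?L = _ ` ?R")
    proof (intro equalityI subsetI)
      fix u assume "u \<in> ?L"
      then obtain t where t: "u = ereal t" "0 < t" "\<not> (\<exists>Y. switched_solution A B z Y0 t Y)" by blast
      then have "x < t" using small[of t] True
        by (metis ereal_less_eq(3) le_less_trans not_le)
      then have "ereal (t - x) \<in> ?R" using large[of t] t True by auto
      then show "u \<in> (+) (ereal x) ` ?R" using t by (intro image_eqI[of _ _ "ereal (t - x)"]) auto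
    next
      fix u assume "u \<in> (+) (ereal x) ` ?R"
      then obtain t where t: "u = ereal (x + t)" "0 < t"
        "\<not> (\<exists>Y. switched_solution A B (\<lambda>r. z (r + x)) (riccati_flow C x Y0) t Y)" by auto
      then show "u \<in> ?L" using large[of "x + t"] x by auto
    qed
    then show ?thesis
      using True unfolding switched_escape_time_def by (simp add: Inf_ereal_translate)
  next
    case False
    then obtain e where e: "rde_escape_time C Y0 = ereal e" "0 < e" "e \<le> x"
      using rde_escape_time_pos[of C Y0] by (cases "rde_escape_time C Y0") auto
    \<comment> \<open>Beyond \<open>x\<close> both sides are false: solvability there would require
      the flow to live past \<open>x\<close>, whereas \<open>e \<le> x\<close>.\<close>
    have "(\<exists>Y. switched_solution A B z Y0 t Y) \<longleftrightarrow> t < e" if "0 < t" for t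
      using small[OF that] large[of t] e by (cases "t \<le> x") auto
    then have "0 < t \<and> \<not> (\<exists>Y. switched_solution A B z Y0 t Y) \<longleftrightarrow> e \<le> t" for t
      using e(2) by (meson less_le_trans not_less)
    then have "{ereal t |t. 0 < t \<and> \<not> (\<exists>Y. switched_solution A B z Y0 t Y)} = {ereal t |t. e \<le> t}"
      by simp
    moreover have "Inf {ereal t |t. e \<le> t} = ereal e"
      by (rule Inf_eqI) auto
    ultimately show ?thesis using False e by (simp add: switched_escape_time_def)
  qed
qed

lemma switched_escape_time_nonneg: "0 \<le> switched_escape_time A B z Y0"
  unfolding switched_escape_time_def by (auto intro!: Inf_greatest)

text \<open>
  The embedded chain: \<open>X i\<close> is the time between the switches number \<open>i\<close> and \<open>i + 1\<close>, and
  \<open>phase c i\<close> tells whether \<open>A\<close> or \<open>B\<close> acts in between.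
\<close>

definition phase :: "bool \<Rightarrow> nat \<Rightarrow> bool" where
  "phase c n \<longleftrightarrow> (if even n then c else \<not> c)"

lemma phase_simps [simp]: "phase c 0 = c" "phase c (Suc n) = (\<not> phase c n)"
  by (auto simp: phase_def)

text \<open>Real valued in order to be compared with the lengths of the periods. An infinite escape
  time would become \<open>0\<close>; the uniform bound on the escape times rules this out.\<close>

definition active_escape ::
  "real^('k::finite + 'm::finite)^('k + 'm) \<Rightarrow> real^('k + 'm)^('k + 'm) \<Rightarrow> bool \<Rightarrow> real^'k^'m \<Rightarrow> real" where
  "active_escape A B c Y = real_of_ereal (rde_escape_time (if c then A else B) Y)"

text \<open>After an escape the recursion goes on with meaningless values of
  \<open>riccati_flow\<close>; the factor \<open>survives\<close> removes them from all
  formulas.\<close>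

primrec switch_state ::
  "real^('k::finite + 'm::finite)^('k + 'm) \<Rightarrow> real^('k + 'm)^('k + 'm) \<Rightarrow> bool \<Rightarrow> real^'k^'m \<Rightarrow>
   (nat \<Rightarrow> real) \<Rightarrow> nat \<Rightarrow> real^'k^'m" where
  "switch_state A B c Y X 0 = Y"
| "switch_state A B c Y X (Suc n) =
    riccati_flow (if phase c n then A else B) (X n) (switch_state A B c Y X n)"

definition survives ::
  "real^('k::finite + 'm::finite)^('k + 'm) \<Rightarrow> real^('k + 'm)^('k + 'm) \<Rightarrow> bool \<Rightarrow> real^'k^'m \<Rightarrow>
   (nat \<Rightarrow> real) \<Rightarrow> nat \<Rightarrow> bool" where
  "survives A B c Y X n \<longleftrightarrow> (\<forall>i<n. X i < active_escape A B (phase c i) (switch_state A B c Y X i))"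

lemma survives_0 [simp]: "survives A B c Y X 0"
  by (simp add: survives_def)

lemma survives_Suc: "survives A B c Y X (Suc n) \<longleftrightarrow>
    survives A B c Y X n \<and> X n < active_escape A B (phase c n) (switch_state A B c Y X n)"
  by (auto simp: survives_def less_Suc_eq)

section \<open>Splitting the escape time into periods\<close>

lemma e2ennreal_ereal_plus:
  assumes "0 \<le> x" "0 \<le> u"
  shows "e2ennreal (ereal x + u) = ennreal x + e2ennreal u"
  using assms by (cases u) auto

text \<open>Each induction step applies the renewal identity to the remainder, which carries the
  factor \<open>survives\<close> because there is time left only if no escape has occurred.\<close>

lemma switched_escape_time_partial_sum:
  fixes z :: "real \<Rightarrow> real" and Y :: "real^'k::finite^'m::finite"
    and A B :: "real^('k + 'm)^('k + 'm)"
  assumes S: "S 0 = 0" "\<And>n. S n < S (Suc n)"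
    and z: "\<And>n t. S n \<le> t \<Longrightarrow> t < S (Suc n) \<Longrightarrow> z t = of_bool (phase c n)"
    and fin: "\<And>c Y. rde_escape_time (if c then A else B) Y < \<infinity>"
    and X_def: "\<And>i. X i = S (Suc i) - S i"
  shows "e2ennreal (switched_escape_time A B z Y) =
    (\<Sum>i<n. of_bool (survives A B c Y X i) *
        ennreal (min (X i) (active_escape A B (phase c i) (switch_state A B c Y X i)))) +
    of_bool (survives A B c Y X n) *
      e2ennreal (switched_escape_time A B (\<lambda>t. z (t + S n)) (switch_state A B c Y X n))"
proof (induction n)
  case 0
  then show ?case by (simp add: S)
next
  case (Suc n)
  define C where "C = (if phase c n then A else B)"
  define V where "V = switch_state A B c Y X n"
  define e where "e = active_escape A B (phase c n) V"
  have e: "rde_escape_time C V = ereal e" "0 < e"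
    using fin[of "phase c n" V] rde_escape_time_pos[of C V]
    by (cases "rde_escape_time C V"; auto simp: e_def active_escape_def C_def)+
  have "e2ennreal (switched_escape_time A B (\<lambda>t. z (t + S n)) V) =
    ennreal (min (X n) e) + of_bool (X n < e) *
      e2ennreal (switched_escape_time A B (\<lambda>t. z (t + S (Suc n))) (switch_state A B c Y X (Suc n)))"
  proof -
    have "switched_escape_time A B (\<lambda>t. z (t + S n)) V = (if ereal (X n) < rde_escape_time C V
      then ereal (X n) + switched_escape_time A B (\<lambda>r. z (r + X n + S n)) (riccati_flow C (X n) V)
      else rde_escape_time C V)"
      unfolding C_def
      by (rule switched_escape_time_shift[OF z]) (auto simp: X_def S(2))
    moreover have "z (r + X n + S n) = z (r + S (Suc n))" for r
      by (simp add: X_def)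
    ultimately show ?thesis
      using S(2)[of n] e
      by (auto simp flip: C_def V_def simp: min_def X_def e2ennreal_ereal_plus[OF _ switched_escape_time_nonneg])
  qed
  with Suc show ?case
    by (auto simp: survives_Suc V_def[symmetric] e_def[symmetric] add.assoc)
qed

lemma switched_escape_time_suminf:
  fixes z :: "real \<Rightarrow> real" and Y :: "real^'k::finite^'m::finite"
    and A B :: "real^('k + 'm)^('k + 'm)"
  assumes S: "S 0 = 0" "\<And>n. S n < S (Suc n)" "\<And>t. \<exists>n. t < S n"
    and z: "\<And>n t. S n \<le> t \<Longrightarrow> t < S (Suc n) \<Longrightarrow> z t = of_bool (phase c n)"
    and fin: "\<And>c Y. rde_escape_time (if c then A else B) Y < \<infinity>"
    and X_def: "\<And>i. X i = S (Suc i) - S i"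
  shows "e2ennreal (switched_escape_time A B z Y) =
    (\<Sum>i. of_bool (survives A B c Y X i) *
        ennreal (min (X i) (active_escape A B (phase c i) (switch_state A B c Y X i))))"
    (is "?E = (\<Sum>i. ?f i)")
proof (rule antisym)
  have partial: "?E = (\<Sum>i<n. ?f i) + of_bool (survives A B c Y X n) *
      e2ennreal (switched_escape_time A B (\<lambda>t. z (t + S n)) (switch_state A B c Y X n))" for n
    by (rule switched_escape_time_partial_sum[OF S(1,2) z fin X_def])
  have lower: "(\<Sum>i<n. ?f i) \<le> ?E" for n
    by (subst partial[of n]) simp
  then show "(\<Sum>i. ?f i) \<le> ?E"
    by (intro suminf_le_const summableI)
  show "?E \<le> (\<Sum>i. ?f i)"
  proof (cases "\<forall>n. survives A B c Y X n")
    case False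
    then obtain n where "\<not> survives A B c Y X n" by blast
    then have "?E = (\<Sum>i<n. ?f i)" by (subst partial[of n]) simp
    also have "\<dots> \<le> (\<Sum>i. ?f i)" by (intro sum_le_suminf) auto
    finally show ?thesis .
  next
    case True
    \<comment> \<open>If every period survives, the summands are the full lengths
      \<open>X i\<close>, whose partial sums \<open>S n\<close> are unbounded. The series is then
      infinite, and the remainder needs no estimate.\<close>
    have "?f i = ennreal (X i)" for i
      using True survives_Suc[of A B c Y X i] by (simp add: min_def)
    then have S_le: "ennreal (S n) \<le> (\<Sum>i. ?f i)" for n
    proof -
      have "ennreal (S n) = (\<Sum>i<n. ennreal (X i))"
        using S(2) by (subst sum_ennreal) (auto simp: X_def sum_lessThan_telescope S(1) less_imp_le)
      also have "\<dots> = (\<Sum>i<n. ?f i)" using \<open>\<And>i. ?f i = ennreal (X i)\<close> by simp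
      also have "\<dots> \<le> (\<Sum>i. ?f i)" by (intro sum_le_suminf) auto
      finally show ?thesis .
    qed
    have "(\<Sum>i. ?f i) = \<top>"
    proof (rule ccontr)
      assume "(\<Sum>i. ?f i) \<noteq> \<top>"
      then obtain r where r: "(\<Sum>i. ?f i) = ennreal r" "0 \<le> r"
        by (cases "\<Sum>i. ?f i") auto
      obtain n where "r < S n" using S(3) by blast
      then show False using S_le[of n] r by (simp add: ennreal_le_iff)
    qed
    then show ?thesis by simp
  qed
qed

text \<open>By the hypothesis on \<open>p\<close> it counts the points \<open>S\<close>: it equals
  \<open>n\<close> from \<open>S n\<close> until just before \<open>S (Suc n)\<close>, so its jumps
  have size one and sit at the points \<open>S (Suc i)\<close>. Each switch adds a term
  \<open>1 - 2 * v\<close> to the sum, where \<open>v\<close> is the left limit of \<open>z\<close>,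
  and thereby replaces \<open>v\<close> by \<open>1 - v\<close>.\<close>

lemma switching_path_phase:
  fixes S :: "nat \<Rightarrow> real"
  assumes S: "S 0 = 0" "\<And>n. S n < S (Suc n)"
    and p: "\<And>n t. 0 \<le> t \<Longrightarrow> n \<le> p t \<longleftrightarrow> S n \<le> t"
    and z: "switching_path p z" "z 0 = of_bool c"
    and t: "S n \<le> t" "t < S (Suc n)"
  shows "z t = of_bool (phase c n)"
proof -
  have mono: "strict_mono S" using S(2) by (simp add: strict_mono_Suc_iff)
  have S0: "0 \<le> S n" for n using strict_mono_less_eq[OF mono, of 0 n] S(1) by simp
  have val: "p t = n" if "S n \<le> t" "t < S (Suc n)" for n t
    using p[of t n] p[of t "Suc n"] that S0[of n] by simp
  have left: "left_limit h s = h0" if "S n < s" "\<And>r. S n < r \<Longrightarrow> r < s \<Longrightarrow> h r = h0" for h s h0 n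
    unfolding left_limit_def
  proof (rule tendsto_Lim)
    have "eventually (\<lambda>r. r \<in> {S n<..<s}) (at_left s)"
      using that(1) by (rule eventually_at_left_real)
    then show "(h \<longlongrightarrow> h0) (at_left s)"
      by (rule tendsto_eventually[OF eventually_mono]) (use that(2) in auto)
  qed simp
  have ex: "\<exists>n. S n < s \<and> s \<le> S (Suc n)" if pos: "0 < s" for s
  proof -
    \<comment> \<open>As \<open>p s\<close> is a natural number, some point of \<open>S\<close> lies
      beyond \<open>s\<close>; the least index \<open>k\<close> with \<open>s \<le> S k\<close> is a
      successor because \<open>S 0 = 0 < s\<close>.\<close>
    have "s < S (Suc (p s))" using p[of s "Suc (p s)"] that by simp
    define m where "m = (LEAST k. s \<le> S k)"
    have m: "s \<le> S m" unfolding m_def by (rule LeastI[of _ "Suc (p s)"]) (use \<open>s < S (Suc (p s))\<close> in simp)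
    then obtain k where k: "m = Suc k" using S(1) pos by (cases m) auto
    have "\<not> s \<le> S k" using not_less_Least[of k "\<lambda>k. s \<le> S k"] k by (simp add: m_def)
    then show ?thesis using m k by (intro exI[of _ k]) simp
  qed
  have jump: "jump p s = of_bool (s = S (Suc n))" if "S n < s" "s \<le> S (Suc n)" for s n
  proof -
    have "left_limit (\<lambda>s. real (p s)) s = real n"
      by (rule left[OF that(1)]) (use that in \<open>simp add: val\<close>)
    moreover have "p s = (if s = S (Suc n) then Suc n else n)"
      using val[of n s] val[of "Suc n" s] that S(2)[of "Suc n"] by auto
    ultimately show ?thesis by (simp add: jump_def)
  qed
  have jump_S: "jump p (S (Suc i)) = 1" for i
    using jump[of i "S (Suc i)"] S(2) by simp
  define zz where "zz = (\<lambda>n. z 0 + (\<Sum>i<n. 1 - 2 * left_limit z (S (Suc i))))"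
  have zt: "z t = zz n" if "S n \<le> t" "t < S (Suc n)" for t n
  proof -
    have "{s \<in> {0<..t}. jump p s \<noteq> 0} = (\<lambda>i. S (Suc i)) ` {..<n}"
    proof (intro equalityI subsetI)
      fix s assume s: "s \<in> {s \<in> {0<..t}. jump p s \<noteq> 0}"
      then obtain k where k: "S k < s" "s \<le> S (Suc k)" using ex by auto
      then have "s = S (Suc k)" using jump[OF k] s by (auto split: if_splits)
      moreover have "Suc k < Suc n"
        using s \<open>s = S (Suc k)\<close> that strict_mono_less[OF mono, of "Suc k" "Suc n"] by auto
      ultimately show "s \<in> (\<lambda>i. S (Suc i)) ` {..<n}" by auto
    next
      fix s assume "s \<in> (\<lambda>i. S (Suc i)) ` {..<n}"
      then obtain i where i: "s = S (Suc i)" "i < n" by auto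
      then have "S 0 < s" "s \<le> S n"
        using strict_mono_less[OF mono, of 0 "Suc i"] strict_mono_less_eq[OF mono, of "Suc i" n] by auto
      then show "s \<in> {s \<in> {0<..t}. jump p s \<noteq> 0}"
        using that i jump_S S(1) by auto
    qed
    moreover have "z t = z 0 + (\<Sum>s | s \<in> {0<..t} \<and> jump p s \<noteq> 0. (1 - 2 * left_limit z s) * jump p s)"
      using z(1) order_trans[OF S0 that(1)] unfolding switching_path_def by blast
    moreover have "inj_on (\<lambda>i. S (Suc i)) {..<n}"
      using strict_mono_eq[OF mono] by (auto simp: inj_on_def)
    ultimately show ?thesis
      by (simp add: zz_def sum.reindex jump_S)
  qed
  have "zz (Suc n) = 1 - zz n" for n
  proof -
    have "left_limit z (S (Suc n)) = zz n"
      by (rule left[OF S(2)]) (simp add: zt)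
    then show ?thesis by (simp add: zz_def)
  qed
  moreover have "zz 0 = of_bool c" by (simp add: zz_def z(2))
  ultimately have "zz n = of_bool (phase c n)"
    by (induction n) auto
  then show ?thesis using zt[OF t] by simp
qed

section \<open>Interarrival times of the Poisson process\<close>

lemma (in prob_space) AE_ex_notin_if_prob_tendsto_0:
  assumes "\<And>k. E k \<in> events" "(\<lambda>k. prob (E k)) \<longlonglongrightarrow> 0"
  shows "AE w in M. \<exists>k :: nat. w \<notin> E k"
proof (rule AE_I')
  have ev: "(\<Inter>k. E k) \<in> events" using assms(1) by auto
  have "prob (\<Inter>k. E k) \<le> prob (E k)" for k
    by (rule finite_measure_mono) (use assms(1) in auto)
  then have "prob (\<Inter>k. E k) \<le> 0"
    by (intro LIMSEQ_le_const[OF assms(2)]) auto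
  then show "(\<Inter>k. E k) \<in> null_sets M"
    using ev by (intro null_setsI) (auto simp: emeasure_eq_measure measure_le_0_iff)
qed auto

lemma poisson_lessThan_tendsto_0:
  assumes "0 < lam"
  shows "(\<lambda>k. measure_pmf.prob (poisson_pmf (lam * real (Suc k))) {..<n}) \<longlonglongrightarrow> 0"
proof -
  have "(\<lambda>k. \<Sum>i<n. (lam * real (Suc k)) ^ i / fact i * exp (- (lam * real (Suc k)))) \<longlonglongrightarrow> (\<Sum>i<n. 0)"
  proof (intro tendsto_sum)
    fix i
    have "filterlim (\<lambda>k. lam * real (Suc k)) at_top sequentially"
      using assms by (intro filterlim_tendsto_pos_mult_at_top[OF tendsto_const]) (auto intro!: filterlim_compose[OF filterlim_real_sequentially filterlim_Suc] simp del: of_nat_Suc)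
    from filterlim_compose[OF tendsto_power_div_exp_0[of i] this]
    have "(\<lambda>k. (lam * real (Suc k)) ^ i / exp (lam * real (Suc k)) / fact i) \<longlonglongrightarrow> 0 / fact i"
      by (intro tendsto_divide tendsto_const) auto
    then show "(\<lambda>k. (lam * real (Suc k)) ^ i / fact i * exp (- (lam * real (Suc k)))) \<longlonglongrightarrow> 0"
      by (simp add: exp_minus field_simps del: of_nat_Suc)
  qed
  moreover have "measure_pmf.prob (poisson_pmf (lam * real (Suc k))) {..<n} =
      (\<Sum>i<n. (lam * real (Suc k)) ^ i / fact i * exp (- (lam * real (Suc k))))" for k
    using assms by (subst measure_measure_pmf_finite) (auto simp del: of_nat_Suc)
  ultimately show ?thesis by simp
qed

text \<open>From \<open>exp (- \<mu>) \<ge> 1 - \<mu>\<close>. The second order in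
  \<open>\<mu>\<close> is what counts: over \<open>m\<close> cells of length \<open>1 / m\<close>
  the bounds add up to order \<open>1 / m\<close>.\<close>

lemma poisson_atLeast_2_le:
  assumes "0 < \<mu>"
  shows "measure_pmf.prob (poisson_pmf \<mu>) {2..} \<le> \<mu>\<^sup>2"
proof -
  have "{2..} = - {0, 1 :: nat}" by auto
  then have "measure_pmf.prob (poisson_pmf \<mu>) {2..} = 1 - measure_pmf.prob (poisson_pmf \<mu>) {0, 1}"
    using measure_pmf.prob_compl[of "{0, 1}" "poisson_pmf \<mu>"] by (simp add: Compl_eq_Diff_UNIV)
  also have "measure_pmf.prob (poisson_pmf \<mu>) {0, 1} = exp (-\<mu>) * (1 + \<mu>)"
    using assms by (subst measure_measure_pmf_finite) (auto simp: algebra_simps)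
  also have "1 - exp (-\<mu>) * (1 + \<mu>) \<le> 1 - (1 - \<mu>) * (1 + \<mu>)"
    using exp_ge_add_one_self[of "-\<mu>"] assms by (intro diff_left_mono mult_right_mono) auto
  finally show ?thesis by (simp add: power2_eq_square algebra_simps)
qed

section \<open>Paths of the Poisson process and their jump times\<close>

locale poisson =
  fixes W :: "'w measure" and lam :: real and N :: "real \<Rightarrow> 'w \<Rightarrow> nat"
  assumes poisson: "poisson_process W lam N"
begin

sublocale prob_space W
  using poisson by (simp add: poisson_process_def)

lemma lam_pos: "0 < lam"
  using poisson by (simp add: poisson_process_def)

lemma measurable_N [measurable]: "0 \<le> t \<Longrightarrow> N t \<in> measurable W (count_space UNIV)"
  using poisson by (simp add: poisson_process_def)

lemma N_0: "w \<in> space W \<Longrightarrow> N 0 w = 0"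
  using poisson by (simp add: poisson_process_def)

lemma N_mono: "w \<in> space W \<Longrightarrow> 0 \<le> s \<Longrightarrow> s \<le> t \<Longrightarrow> N s w \<le> N t w"
  using poisson by (auto simp: poisson_process_def mono_on_def)

lemma N_right_constant:
  assumes "w \<in> space W" "0 \<le> t"
  obtains e where "0 < e" "\<And>r. t \<le> r \<Longrightarrow> r < t + e \<Longrightarrow> N r w = N t w"
proof -
  have "continuous (at_right t) (\<lambda>s. N s w)"
    using poisson assms by (auto simp: poisson_process_def)
  then have "eventually (\<lambda>s. N s w = N t w) (at_right t)"
    by (simp add: continuous_within tendsto_discrete)
  then obtain b where "t < b" "\<And>r. t < r \<Longrightarrow> r < b \<Longrightarrow> N r w = N t w"
    by (auto simp: eventually_at_right_field)
  then show thesis by (intro that[of "b - t"]) (auto simp: le_less)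
qed

lemma prob_increment:
  assumes "0 \<le> s" "s < t"
  shows "prob {w \<in> space W. N t w - N s w \<in> K} = measure_pmf.prob (poisson_pmf (lam * (t - s))) K"
proof -
  have [measurable]: "N s \<in> measurable W (count_space UNIV)" "N t \<in> measurable W (count_space UNIV)"
    using assms by auto
  have "distr W (count_space UNIV) (\<lambda>w. N t w - N s w) = measure_pmf (poisson_pmf (lam * (t - s)))"
    using poisson assms by (simp add: poisson_process_def)
  then have "measure_pmf.prob (poisson_pmf (lam * (t - s))) K
      = measure (distr W (count_space UNIV) (\<lambda>w. N t w - N s w)) K" by simp
  also have "\<dots> = prob {w \<in> space W. N t w - N s w \<in> K}"
    by (subst measure_distr) (auto intro!: arg_cong[where f=prob])
  finally show ?thesis by simp
qed

lemma AE_unbounded: "AE w in W. \<forall>n. \<exists>t\<ge>0. n \<le> N t w"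
proof (subst AE_all_countable, intro allI)
  fix n
  have "(\<lambda>k. prob {w \<in> space W. N (real (Suc k)) w < n}) \<longlonglongrightarrow> 0"
  proof -
    have "{w \<in> space W. N (real (Suc k)) w < n} = {w \<in> space W. N (real (Suc k)) w - N 0 w \<in> {..<n}}" for k
      by (auto simp: N_0)
    then have "prob {w \<in> space W. N (real (Suc k)) w < n} = measure_pmf.prob (poisson_pmf (lam * real (Suc k))) {..<n}" for k
      using prob_increment[of 0 "real (Suc k)" "{..<n}"] by simp
    then show ?thesis
      using poisson_lessThan_tendsto_0[OF lam_pos, of n] by simp
  qed
  moreover have "{w \<in> space W. N (real (Suc k)) w < n} \<in> events" for k
    by measurable
  ultimately have "AE w in W. \<exists>k. w \<notin> {w \<in> space W. N (real (Suc k)) w < n}"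
    by (intro AE_ex_notin_if_prob_tendsto_0)
  then show "AE w in W. \<exists>t\<ge>0. n \<le> N t w"
  proof (rule AE_mp, intro AE_I2 impI)
    fix w assume w: "w \<in> space W" "\<exists>k. w \<notin> {w \<in> space W. N (real (Suc k)) w < n}"
    then obtain k where "n \<le> N (real (Suc k)) w" by (auto simp: not_less)
    then show "\<exists>t\<ge>0. n \<le> N t w" by (intro exI[of _ "real (Suc k)"]) auto
  qed
qed

text \<open>Each of the \<open>T * m\<close> cells of mesh \<open>1 / m\<close> has an increment of
  two or more with probability at most \<open>(lam / m)\<^sup>2\<close>. The sum
  \<open>T * lam\<^sup>2 / m\<close> tends to zero, so almost surely some mesh is free of such
  cells; one mesh per horizon \<open>T\<close> suffices to exclude multiple jumps.\<close>

lemma AE_grid_increments: "AE w in W. \<forall>T :: nat. \<exists>m :: nat. 0 < m \<and>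
  (\<forall>j < T * m. N (real (Suc j) / real m) w - N (real j / real m) w \<le> 1)"
proof (subst AE_all_countable, intro allI)
  fix T :: nat
  define I where "I = (\<lambda>m j. {w \<in> space W. N (real (Suc j) / real (Suc m)) w - N (real j / real (Suc m)) w \<in> {2..}})"
  define E where "E = (\<lambda>m. \<Union>j<T * Suc m. I m j)"
  have [measurable]: "I m j \<in> events" for m j
    unfolding I_def by measurable
  have E: "E m \<in> events" for m
    unfolding E_def by measurable
  have bound: "prob (E m) \<le> real T * lam\<^sup>2 * inverse (real (Suc m))" for m
  proof -
    have "prob (I m j) \<le> (lam / real (Suc m))\<^sup>2" for j
    proof -
      have "real (Suc j) / real (Suc m) - real j / real (Suc m) = 1 / real (Suc m)"
        by (simp add: diff_divide_distrib[symmetric])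
      then show ?thesis
        unfolding I_def using prob_increment[of "real j / real (Suc m)" "real (Suc j) / real (Suc m)" "{2..}"]
          poisson_atLeast_2_le[of "lam / real (Suc m)"] lam_pos
        by (simp add: divide_strict_right_mono)
    qed
    then have "prob (E m) \<le> (\<Sum>j<T * Suc m. (lam / real (Suc m))\<^sup>2)"
      unfolding E_def by (intro order_trans[OF finite_measure_subadditive_finite] sum_mono) auto
    also have "\<dots> = real T * real (Suc m) * (lam / real (Suc m))\<^sup>2"
      by (simp only: sum_constant card_lessThan of_nat_mult)
    also have "\<dots> = real T * lam\<^sup>2 * inverse (real (Suc m))"
      by (simp add: power2_eq_square divide_simps del: of_nat_Suc)
    finally show ?thesis .
  qed
  have "(\<lambda>m. prob (E m)) \<longlonglongrightarrow> 0"
  proof (rule tendsto_sandwich[OF always_eventually always_eventually tendsto_const])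
    show "(\<lambda>m. real T * lam\<^sup>2 * inverse (real (Suc m))) \<longlonglongrightarrow> 0"
      by (rule tendsto_mult_right_zero[OF LIMSEQ_inverse_real_of_nat])
  qed (intro allI bound measure_nonneg)+
  from AE_ex_notin_if_prob_tendsto_0[OF E this] have "AE w in W. \<exists>k. w \<notin> E k" .
  then show "AE w in W. \<exists>m. 0 < m \<and> (\<forall>j < T * m. N (real (Suc j) / real m) w - N (real j / real m) w \<le> 1)"
  proof (rule AE_mp, intro AE_I2 impI)
    fix w assume w: "w \<in> space W" "\<exists>k. w \<notin> E k"
    then obtain k where "w \<notin> E k" by blast
    then show "\<exists>m. 0 < m \<and> (\<forall>j < T * m. N (real (Suc j) / real m) w - N (real j / real m) w \<le> 1)"
      using w(1) by (intro exI[of _ "Suc k"])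
        (force simp: E_def I_def not_le less_Suc_eq_le numeral_2_eq_2 simp del: of_nat_Suc mult_Suc_right)
  qed
qed

text \<open>The time of the jump number \<open>n\<close>, with junk value \<open>0\<close> if the path has fewer jumps.\<close>

definition hit :: "nat \<Rightarrow> 'w \<Rightarrow> real" where
  "hit n w = (if \<exists>t\<ge>0. n \<le> N t w then Inf {t. 0 \<le> t \<and> n \<le> N t w} else 0)"

lemma hit_0: "w \<in> space W \<Longrightarrow> hit 0 w = 0"
  unfolding hit_def by (auto intro!: cInf_eq_minimum)

lemma hit_nonneg: "0 \<le> hit n w"
  unfolding hit_def by (auto intro!: cInf_greatest)

lemma hit_le_iff:
  assumes w: "w \<in> space W" and ex: "\<exists>t\<ge>0. n \<le> N t w" and t: "0 \<le> t"
  shows "hit n w \<le> t \<longleftrightarrow> n \<le> N t w"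
proof
  define A where "A = {t. 0 \<le> t \<and> n \<le> N t w}"
  have h: "hit n w = Inf A" using ex by (simp add: hit_def A_def)
  have A: "A \<noteq> {}" "bdd_below A" using ex by (auto simp: A_def)
  {
    assume "n \<le> N t w"
    then show "hit n w \<le> t" unfolding h using t A(2) by (auto simp: A_def intro: cInf_lower)
  }
  assume "hit n w \<le> t"
  \<comment> \<open>The path is constant immediately to the right of the infimum, so the infimum is
    attained.\<close>
  obtain e where e: "0 < e" "\<And>r. hit n w \<le> r \<Longrightarrow> r < hit n w + e \<Longrightarrow> N r w = N (hit n w) w"
    using N_right_constant[OF w hit_nonneg] by blast
  obtain r where r: "r \<in> A" "r < hit n w + e"
    using cInf_lessD[OF A(1), of "hit n w + e"] e(1) h by auto
  then have "hit n w \<le> r" unfolding h using A(2) by (auto intro: cInf_lower)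
  then have "n \<le> N (hit n w) w" using e(2)[of r] r by (simp add: A_def)
  also have "\<dots> \<le> N t w" by (rule N_mono[OF w hit_nonneg \<open>hit n w \<le> t\<close>])
  finally show "n \<le> N t w" .
qed

text \<open>Paths without the null events of a bounded path or a jump of size at least two.\<close>

definition regular :: "'w \<Rightarrow> bool" where
  "regular w \<longleftrightarrow> (\<forall>n. \<exists>t\<ge>0. n \<le> N t w) \<and> (\<forall>n. N (hit n w) w = n)"

lemma AE_regular: "AE w in W. regular w"
  using AE_unbounded AE_grid_increments AE_space
proof eventually_elim
  case (elim w)
  have iff: "hit n w \<le> t \<longleftrightarrow> n \<le> N t w" if "0 \<le> t" for n t
    using elim that by (intro hit_le_iff) auto
  have "N (hit n w) w = n" for n
  proof (rule ccontr)
    assume "N (hit n w) w \<noteq> n"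
    then have ge: "Suc n \<le> N (hit n w) w"
      using iff[of "hit n w" n] hit_nonneg[of n w] by simp
    have "0 < hit n w"
      using hit_nonneg[of n w] ge N_0[OF elim(3)] by (cases "hit n w = 0") auto
    obtain T :: nat where T: "hit n w \<le> real T" using real_arch_simple by blast
    obtain m :: nat where m: "0 < m"
      "\<And>j. j < T * m \<Longrightarrow> N (real (Suc j) / real m) w - N (real j / real m) w \<le> 1"
      using elim(2) by blast
    have pos: "0 < hit n w * real m" using \<open>0 < hit n w\<close> m by simp
    \<comment> \<open>The cell from \<open>j / m\<close> to \<open>Suc j / m\<close>, open on the
      left, contains the hitting time. The path is below \<open>n\<close> at its left end and at
      least \<open>Suc n\<close> at its right end, an increment of two.\<close>
    define k where "k = nat \<lceil>hit n w * real m\<rceil>"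
    have k: "hit n w * real m \<le> real k" "real k < hit n w * real m + 1"
      using pos unfolding k_def by linarith+
    with pos obtain j where j: "k = Suc j" by (cases k) auto
    have "real j < hit n w * real m" using k(2) j by simp
    also have "\<dots> \<le> real (T * m)" using T m by (simp add: mult_right_mono)
    finally have "j < T * m" by (simp only: of_nat_less_iff)
    have "\<not> hit n w \<le> real j / real m"
      using \<open>real j < hit n w * real m\<close> m(1) by (simp add: pos_le_divide_eq)
    then have "N (real j / real m) w < n"
      using iff[of "real j / real m" n] by simp
    moreover have "N (hit n w) w \<le> N (real (Suc j) / real m) w"
      by (rule N_mono[OF elim(3) hit_nonneg]) (use k(1) j m in \<open>simp add: field_simps\<close>)
    ultimately show False using m(2)[OF \<open>j < T * m\<close>] ge by linarith
  qed
  with elim show ?case by (simp add: regular_def)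
qed

lemma regular_hit_le_iff:
  "w \<in> space W \<Longrightarrow> regular w \<Longrightarrow> 0 \<le> t \<Longrightarrow> hit n w \<le> t \<longleftrightarrow> n \<le> N t w"
  by (intro hit_le_iff) (auto simp: regular_def)

lemma regular_hit_strict_mono:
  assumes "w \<in> space W" "regular w"
  shows "hit n w < hit (Suc n) w"
  using regular_hit_le_iff[OF assms hit_nonneg, of "Suc n" n w] assms by (auto simp: regular_def not_le[symmetric])

lemma regular_hit_unbounded:
  assumes "w \<in> space W" "regular w"
  shows "\<exists>n. t < hit n w"
proof -
  have "\<not> hit (Suc (N (max 0 t) w)) w \<le> max 0 t"
    using regular_hit_le_iff[OF assms, of "max 0 t" "Suc (N (max 0 t) w)"] by simp
  then show ?thesis by (intro exI[of _ "Suc (N (max 0 t) w)"]) linarith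
qed

text \<open>Measurability holds on the whole space and not only on regular paths: the paths that
  never reach \<open>n\<close>, which have the value \<open>0\<close>, are recognized at integer
  times.\<close>

lemma hit_measurable [measurable]: "hit n \<in> borel_measurable W"
proof (rule borel_measurable_iff_le[THEN iffD2], intro allI)
  fix a
  show "{w \<in> space W. hit n w \<le> a} \<in> events"
  proof (cases "0 \<le> a")
    case False
    then have "\<not> hit n w \<le> a" for w using hit_nonneg[of n w] by linarith
    then show ?thesis by simp
  next
    case True
    have "hit n w \<le> a \<longleftrightarrow> n \<le> N a w \<or> (\<forall>k. N (real k) w < n)" if w: "w \<in> space W" for w
    proof (cases "\<exists>t\<ge>0. n \<le> N t w")
      case ex: True
      then obtain t where t: "0 \<le> t" "n \<le> N t w" by blast
      obtain k :: nat where "t \<le> real k" using real_arch_simple by blast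
      then have "n \<le> N (real k) w" using N_mono[OF w t(1)] t(2) le_trans by blast
      then show ?thesis using hit_le_iff[OF w ex True] by (auto simp: not_less[symmetric])
    next
      case False
      then have "N (real k) w < n" for k
        by (meson not_less of_nat_0_le_iff)
      moreover have "hit n w = 0" using False unfolding hit_def by (subst if_not_P) auto
      ultimately show ?thesis using \<open>0 \<le> a\<close> by simp
    qed
    then have "{w \<in> space W. hit n w \<le> a} = {w \<in> space W. n \<le> N a w \<or> (\<forall>k. N (real k) w < n)}"
      by auto
    also have "\<dots> \<in> events" using True by measurable
    finally show ?thesis .
  qed
qed

section \<open>The strong Markov property at the jump times\<close>

lemma prob_no_increment:
  assumes c: "0 \<le> c 0" "\<And>i. i < n \<Longrightarrow> c i \<le> c (Suc i)" "c n \<le> u" and s: "0 \<le> s"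
  shows "prob {w \<in> space W. (\<forall>i\<le>n. i \<le> N (c i) w) \<and> N (u + s) w = N u w}
    = prob {w \<in> space W. \<forall>i\<le>n. i \<le> N (c i) w} * exp (- lam * s)"
proof (cases "s = 0")
  case False
  with s have s: "0 < s" by simp
  \<comment> \<open>One deterministic sequence of times \<open>0, c 0, ..., c n, u, u + s\<close>:
    the increments \<open>0\<close> to \<open>n\<close> determine the event in the past, increment
    \<open>n + 1\<close> from \<open>c n\<close> to \<open>u\<close> is skipped, and increment
    \<open>n + 2\<close> is the one that has to vanish.\<close>
  define \<sigma> :: "nat \<Rightarrow> real" where
    "\<sigma> = (\<lambda>i. if i = 0 then 0 else if i \<le> Suc n then c (i - 1) else if i = n + 2 then u else u + s)"
  have "\<sigma> i \<le> \<sigma> (Suc i)" for i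
  proof -
    consider "i = 0" | "0 < i" "i \<le> n" | "i = Suc n" | "i > Suc n" by linarith
    then show ?thesis
    proof cases
      case 2
      then obtain k where "i = Suc k" by (cases i) auto
      then show ?thesis using 2 c(2)[of k] by (simp add: \<sigma>_def)
    qed (use c s in \<open>auto simp: \<sigma>_def\<close>)
  qed
  then have mono: "mono \<sigma>" by (simp add: mono_iff_le_Suc)
  have \<sigma>_nonneg: "0 \<le> \<sigma> i" for i
    using monoD[OF mono, of 0 i] by (simp add: \<sigma>_def)
  define D where "D = (\<lambda>i w. N (\<sigma> (Suc i)) w - N (\<sigma> i) w)"
  have ind: "indep_vars (\<lambda>_. count_space UNIV) D {..<n+3}"
    using poisson mono \<sigma>_nonneg[of 0] by (auto simp: poisson_process_def D_def)
  have ind2: "indep_var (PiM {..n} (\<lambda>_. count_space UNIV)) (\<lambda>w. \<lambda>i\<in>{..n}. D i w)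
      (PiM {n+2} (\<lambda>_. count_space UNIV)) (\<lambda>w. \<lambda>i\<in>{n+2}. D i w)"
    by (rule indep_var_restrict[OF ind]) auto
  have N_sum: "N (c i) w = (\<Sum>k\<le>i. D k w)" if "w \<in> space W" "i \<le> n" for i w
  proof -
    have "(\<Sum>k\<le>i. D k w) = N (\<sigma> (Suc i)) w" for i
    proof (induction i)
      case 0
      then show ?case using N_0[OF that(1)] by (simp add: D_def \<sigma>_def)
    next
      case (Suc i)
      then show ?case
        using N_mono[OF that(1) \<sigma>_nonneg monoD[OF mono], of "Suc i" "Suc (Suc i)"] by (simp add: D_def)
    qed
    then show ?thesis using that by (simp add: \<sigma>_def)
  qed
  define XA where "XA = {f \<in> space (PiM {..n} (\<lambda>_. count_space (UNIV :: nat set))). \<forall>i\<le>n. i \<le> (\<Sum>k\<le>i. f k)}"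
  define XB where "XB = {f \<in> space (PiM {n+2} (\<lambda>_. count_space (UNIV :: nat set))). f (n+2) = 0}"
  have XA: "XA \<in> sets (PiM {..n} (\<lambda>_. count_space UNIV))"
    unfolding XA_def by measurable
  have XB: "XB \<in> sets (PiM {n+2} (\<lambda>_. count_space UNIV))"
    unfolding XB_def by measurable
  have A: "(\<lambda>w. \<lambda>i\<in>{..n}. D i w) -` XA \<inter> space W = {w \<in> space W. \<forall>i\<le>n. i \<le> N (c i) w}"
    by (auto simp: XA_def space_PiM N_sum)
  have D2: "D (n+2) w = N (u + s) w - N u w" for w
    by (simp add: D_def \<sigma>_def)
  have B: "(\<lambda>w. \<lambda>i\<in>{n+2}. D i w) -` XB \<inter> space W = {w \<in> space W. N (u + s) w - N u w \<in> {0}}"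
    using D2 by (auto simp: XB_def space_PiM)
  have u: "0 \<le> u"
    using \<sigma>_nonneg[of "n+2"] by (simp add: \<sigma>_def)
  have AB: "(\<lambda>w. (\<lambda>i\<in>{..n}. D i w, \<lambda>i\<in>{n+2}. D i w)) -` (XA \<times> XB) \<inter> space W
      = {w \<in> space W. (\<forall>i\<le>n. i \<le> N (c i) w) \<and> N (u + s) w = N u w}"
  proof -
    have "(\<lambda>w. (\<lambda>i\<in>{..n}. D i w, \<lambda>i\<in>{n+2}. D i w)) -` (XA \<times> XB) \<inter> space W
      = ((\<lambda>w. \<lambda>i\<in>{..n}. D i w) -` XA \<inter> space W) \<inter> ((\<lambda>w. \<lambda>i\<in>{n+2}. D i w) -` XB \<inter> space W)"
      by blast
    also have "\<dots> = {w \<in> space W. (\<forall>i\<le>n. i \<le> N (c i) w) \<and> N (u + s) w - N u w = 0}"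
      unfolding A B by blast
    also have "\<dots> = {w \<in> space W. (\<forall>i\<le>n. i \<le> N (c i) w) \<and> N (u + s) w = N u w}"
    proof (intro Collect_cong conj_cong refl)
      fix w assume "w \<in> space W"
      then have "N u w \<le> N (u + s) w" using u s by (intro N_mono) auto
      then show "(N (u + s) w - N u w = 0) = (N (u + s) w = N u w)" by linarith
    qed
    finally show ?thesis .
  qed
  have "prob {w \<in> space W. (\<forall>i\<le>n. i \<le> N (c i) w) \<and> N (u + s) w = N u w}
    = prob {w \<in> space W. \<forall>i\<le>n. i \<le> N (c i) w} * prob {w \<in> space W. N (u + s) w - N u w \<in> {0}}"
    using indep_varD[OF ind2 XA XB] unfolding A B AB .
  also have "prob {w \<in> space W. N (u + s) w - N u w \<in> {0}} = exp (- lam * s)"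
    using lam_pos s by (subst prob_increment[OF u]) (auto simp: measure_pmf_single)
  finally show ?thesis .
qed simp

text \<open>These events are stable under intersection and generate the history up to the jump
  number \<open>n\<close>, so independence only has to be checked on them.\<close>

definition past :: "nat \<Rightarrow> (nat \<Rightarrow> real) \<Rightarrow> 'w set" where
  "past n b = {w \<in> space W. \<forall>i\<le>n. hit i w \<le> b i}"

lemma past_events [measurable]: "past n b \<in> events"
  unfolding past_def by measurable

lemma past_Collect_events:
  assumes "{w \<in> space W. P w} \<in> events"
  shows "{w \<in> past n b. P w} \<in> events"
proof -
  have "{w \<in> past n b. P w} = past n b \<inter> {w \<in> space W. P w}" by (auto simp: past_def)
  then show ?thesis using assms by simp
qed

lemma N_eq_event:
  assumes "0 \<le> s" "0 \<le> t"
  shows "{w \<in> space W. N s w = N t w} \<in> events"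
proof -
  have "{w \<in> space W. N s w = N t w} = (\<Union>k. (N s -` {k} \<inter> space W) \<inter> (N t -` {k} \<inter> space W))"
    by auto
  also have "\<dots> \<in> events"
    using assms by (intro sets.countable_UN' sets.Int measurable_sets[OF measurable_N]) auto
  finally show ?thesis .
qed

lemma hit_le_event: "{w \<in> space W. hit n w \<le> u} \<in> events"
  by measurable

lemma prob_past_no_increment:
  assumes u: "0 \<le> u" "u \<le> v" and s: "0 \<le> s"
  shows "prob {w \<in> past n b. hit n w \<le> u \<and> N (v + s) w = N v w}
    = prob {w \<in> past n b. hit n w \<le> u} * exp (- lam * s)"
proof (cases "\<exists>i\<le>n. b i < 0")
  case True
  then have "past n b = {}"
    using hit_nonneg unfolding past_def by (smt (verit, best) Collect_empty_eq)
  then show ?thesis by simp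
next
  case False
  \<comment> \<open>Jump times increase along regular paths, so a bound at a later index also binds
    the earlier ones. The suffix minima of \<open>b\<close>, cut off at \<open>u\<close>, describe
    the same event almost surely and increase with the index, as \<open>prob_no_increment\<close>
    requires.\<close>
  define c where "c = (\<lambda>i. min (Min (b ` {i..n})) u)"
  have c_le: "t \<le> c i \<longleftrightarrow> (\<forall>j\<in>{i..n}. t \<le> b j) \<and> t \<le> u" if "i \<le> n" for i t
    using that by (simp add: c_def)
  have c0: "0 \<le> c i" if "i \<le> n" for i
    using False u that by (subst c_le) (auto simp: not_less[symmetric])
  have c_Suc: "c i \<le> c (Suc i)" if "i < n" for i
    using c_le[of i "c i"] that by (subst c_le) auto
  have iff: "w \<in> past n b \<and> hit n w \<le> u \<longleftrightarrow> (\<forall>i\<le>n. i \<le> N (c i) w)"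
    if w: "w \<in> space W" "regular w" for w
  proof -
    have mono: "hit i w \<le> hit j w" if "i \<le> j" for i j
      by (rule lift_Suc_mono_le[of "\<lambda>i. hit i w", OF less_imp_le[OF regular_hit_strict_mono[OF w]] that])
    have "w \<in> past n b \<and> hit n w \<le> u \<longleftrightarrow> (\<forall>i\<le>n. hit i w \<le> c i)"
    proof
      assume *: "w \<in> past n b \<and> hit n w \<le> u"
      show "\<forall>i\<le>n. hit i w \<le> c i"
      proof (intro allI impI)
        fix i assume "i \<le> n"
        have "hit i w \<le> b j" if "j \<in> {i..n}" for j
          using * mono[of i j] that order_trans by (fastforce simp: past_def)
        moreover have "hit i w \<le> u" using * mono[OF \<open>i \<le> n\<close>] by simp
        ultimately show "hit i w \<le> c i" using c_le[OF \<open>i \<le> n\<close>] by blast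
      qed
    next
      assume *: "\<forall>i\<le>n. hit i w \<le> c i"
      then show "w \<in> past n b \<and> hit n w \<le> u"
        using c_le w by (auto simp: past_def)
    qed
    also have "\<dots> \<longleftrightarrow> (\<forall>i\<le>n. i \<le> N (c i) w)"
      using regular_hit_le_iff[OF w c0] by blast
    finally show ?thesis .
  qed
  have ev: "{w \<in> space W. \<forall>i\<le>n. i \<le> N (c i) w} \<in> events"
  proof -
    have [measurable]: "N (max 0 (c i)) \<in> measurable W (count_space UNIV)" for i
      by (rule measurable_N) simp
    have "{w \<in> space W. \<forall>i\<le>n. i \<le> N (max 0 (c i)) w} \<in> events" by measurable
    also have "{w \<in> space W. \<forall>i\<le>n. i \<le> N (max 0 (c i)) w} = {w \<in> space W. \<forall>i\<le>n. i \<le> N (c i) w}"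
      using c0 by (auto simp: max_absorb2)
    finally show ?thesis .
  qed
  have "prob {w \<in> past n b. hit n w \<le> u \<and> N (v + s) w = N v w}
    = prob {w \<in> space W. (\<forall>i\<le>n. i \<le> N (c i) w) \<and> N (v + s) w = N v w}"
  proof (rule measure_eq_AE)
    show "AE w in W. w \<in> {w \<in> past n b. hit n w \<le> u \<and> N (v + s) w = N v w} \<longleftrightarrow>
      w \<in> {w \<in> space W. (\<forall>i\<le>n. i \<le> N (c i) w) \<and> N (v + s) w = N v w}"
      using AE_regular AE_space by eventually_elim (use iff in blast)
    show "{w \<in> space W. (\<forall>i\<le>n. i \<le> N (c i) w) \<and> N (v + s) w = N v w} \<in> events"
      using u s by (intro sets.sets_Collect_conj ev N_eq_event) auto
  qed (use u s in \<open>auto intro!: past_Collect_events sets.sets_Collect_conj N_eq_event hit_le_event\<close>)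
  also have "\<dots> = prob {w \<in> space W. \<forall>i\<le>n. i \<le> N (c i) w} * exp (- lam * s)"
    using c_le[of n "c n"] c0[of 0] u s by (intro prob_no_increment c_Suc) auto
  also have "prob {w \<in> space W. \<forall>i\<le>n. i \<le> N (c i) w} = prob {w \<in> past n b. hit n w \<le> u}"
  proof (rule measure_eq_AE)
    show "AE w in W. w \<in> {w \<in> space W. \<forall>i\<le>n. i \<le> N (c i) w} \<longleftrightarrow> w \<in> {w \<in> past n b. hit n w \<le> u}"
      using AE_regular AE_space by eventually_elim (use iff in blast)
  qed (rule ev past_Collect_events hit_le_event)+
  finally show ?thesis .
qed

lemma prob_past_between_no_increment:
  assumes u: "0 \<le> u" "u \<le> v" and s: "0 \<le> s"
  shows "prob {w \<in> past n b. u < hit n w \<and> hit n w \<le> v \<and> N (v + s) w = N v w}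
    = prob {w \<in> past n b. u < hit n w \<and> hit n w \<le> v} * exp (- lam * s)"
proof -
  have "prob {w \<in> past n b. u < hit n w \<and> hit n w \<le> v \<and> N (v + s) w = N v w}
    = prob ({w \<in> past n b. hit n w \<le> v \<and> N (v + s) w = N v w} - {w \<in> past n b. hit n w \<le> u \<and> N (v + s) w = N v w})"
    by (rule arg_cong[where f = prob]) auto
  also have "\<dots> = prob {w \<in> past n b. hit n w \<le> v \<and> N (v + s) w = N v w}
      - prob {w \<in> past n b. hit n w \<le> u \<and> N (v + s) w = N v w}"
    using u s by (intro finite_measure_Diff) (auto intro!: past_Collect_events sets.sets_Collect_conj N_eq_event hit_le_event)
  also have "\<dots> = (prob {w \<in> past n b. hit n w \<le> v} - prob {w \<in> past n b. hit n w \<le> u}) * exp (- lam * s)"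
    using prob_past_no_increment[of v v s n b] prob_past_no_increment[of u v s n b] u s
    by (simp add: left_diff_distrib)
  also have "prob {w \<in> past n b. hit n w \<le> v} - prob {w \<in> past n b. hit n w \<le> u}
      = prob ({w \<in> past n b. hit n w \<le> v} - {w \<in> past n b. hit n w \<le> u})"
    using u by (intro finite_measure_Diff[symmetric]) (auto intro!: past_Collect_events hit_le_event)
  also have "{w \<in> past n b. hit n w \<le> v} - {w \<in> past n b. hit n w \<le> u} = {w \<in> past n b. u < hit n w \<and> hit n w \<le> v}"
    by auto
  finally show ?thesis .
qed

text \<open>
  \<open>grid_index m n w / m\<close> is the first point of the grid with mesh \<open>1 / m\<close> that is not before the
  hitting time: a stopping time with countably many values that converges to the hitting time
  as \<open>m \<rightarrow> \<infinity>\<close>, which is how the strong Markov property at the hitting time is obtained.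
\<close>

definition grid_index :: "nat \<Rightarrow> nat \<Rightarrow> 'w \<Rightarrow> nat" where
  "grid_index m n w = nat \<lceil>hit n w * real m\<rceil>"

lemma grid_index_event: "{w \<in> space W. grid_index m n w = j} \<in> events"
proof -
  have "grid_index m n \<in> measurable W (count_space UNIV)"
    unfolding grid_index_def by measurable
  from measurable_sets[OF this, of "{j}"] show ?thesis
    by (simp add: vimage_def Int_def conj_ac)
qed

lemma grid_index_eq_iff:
  assumes "0 < m"
  shows "grid_index m n w = 0 \<longleftrightarrow> hit n w \<le> 0"
    and "grid_index m n w = Suc j \<longleftrightarrow> real j / real m < hit n w \<and> hit n w \<le> real (Suc j) / real m"
proof -
  have "hit n w * real m \<le> 0 \<longleftrightarrow> hit n w \<le> 0"
    using assms by (simp add: mult_le_0_iff)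
  then show "grid_index m n w = 0 \<longleftrightarrow> hit n w \<le> 0"
    by (simp add: grid_index_def)
  have "grid_index m n w = Suc j \<longleftrightarrow> \<lceil>hit n w * real m\<rceil> = int (Suc j)"
    unfolding grid_index_def by linarith
  also have "\<dots> \<longleftrightarrow> real j < hit n w * real m \<and> hit n w * real m \<le> real (Suc j)"
    by (auto simp: ceiling_eq_iff)
  finally show "grid_index m n w = Suc j \<longleftrightarrow> real j / real m < hit n w \<and> hit n w \<le> real (Suc j) / real m"
    using assms by (simp add: field_simps)
qed

text \<open>On the event that the grid index is \<open>Suc j\<close>, that is, that the jump falls
  into the cell ending at \<open>Suc j / m\<close>, the grid time is deterministic. The formula is
  summed over these countably many events.\<close>

lemma prob_past_grid:
  assumes m: "0 < m" and s: "0 \<le> s"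
  shows "prob {w \<in> past n b. N (real (grid_index m n w) / real m + s) w = N (real (grid_index m n w) / real m) w}
    = prob (past n b) * exp (- lam * s)"
    and "{w \<in> past n b. N (real (grid_index m n w) / real m + s) w = N (real (grid_index m n w) / real m) w} \<in> events"
proof -
  define E where "E = (\<lambda>j. {w \<in> past n b. grid_index m n w = j})"
  define F where "F = (\<lambda>j. {w \<in> past n b. grid_index m n w = j \<and> N (real j / real m + s) w = N (real j / real m) w})"
  have ev: "E j \<in> events" "F j \<in> events" for j
    unfolding E_def F_def using s
    by (auto intro!: past_Collect_events sets.sets_Collect_conj N_eq_event grid_index_event)
  have EF: "prob (F j) = prob (E j) * exp (- lam * s)" for j
  proof (cases j)
    case 0
    then show ?thesis
      using prob_past_no_increment[of 0 0 s n b] s by (simp add: E_def F_def grid_index_eq_iff[OF m])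
  next
    case (Suc k)
    then show ?thesis
      using prob_past_between_no_increment[of "real k / real m" "real (Suc k) / real m" s n b] s m
      by (simp add: E_def F_def grid_index_eq_iff[OF m] divide_right_mono conj_ac del: of_nat_Suc)
  qed
  have UE: "(\<Union>j. E j) = past n b" by (auto simp: E_def)
  have UF: "(\<Union>j. F j) = {w \<in> past n b. N (real (grid_index m n w) / real m + s) w = N (real (grid_index m n w) / real m) w}"
    by (auto simp: F_def)
  have "(\<lambda>j. prob (E j)) sums prob (\<Union>j. E j)"
    using ev by (intro finite_measure_UNION) (auto simp: disjoint_family_on_def E_def)
  from sums_mult2[OF this, of "exp (- lam * s)"]
  have "(\<lambda>j. prob (F j)) sums (prob (past n b) * exp (- lam * s))" by (simp add: EF UE)
  moreover have "(\<lambda>j. prob (F j)) sums prob (\<Union>j. F j)"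
    using ev by (intro finite_measure_UNION) (auto simp: disjoint_family_on_def F_def)
  ultimately show "prob {w \<in> past n b. N (real (grid_index m n w) / real m + s) w = N (real (grid_index m n w) / real m) w}
    = prob (past n b) * exp (- lam * s)"
    unfolding UF by (rule sums_unique2[symmetric])
  show "{w \<in> past n b. N (real (grid_index m n w) / real m + s) w = N (real (grid_index m n w) / real m) w} \<in> events"
    unfolding UF[symmetric] using ev by auto
qed

definition gap :: "nat \<Rightarrow> 'w \<Rightarrow> real" where
  "gap n w = hit (Suc n) w - hit n w"

lemma gap_measurable [measurable]: "gap n \<in> borel_measurable W"
  unfolding gap_def by measurable

text \<open>By right continuity, on a fine grid the path has the value \<open>n\<close> at the grid
  time and, \<open>s\<close> later, the value that it has at \<open>hit n w + s\<close>. In the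
  limit, no increment means that the next jump comes more than \<open>s\<close> after
  \<open>hit n w\<close>. The grid probabilities do not depend on the mesh, so the limit is
  immediate.\<close>

lemma prob_past_gap:
  assumes s: "0 \<le> s"
  shows "prob {w \<in> past n b. s < gap n w} = prob (past n b) * exp (- lam * s)"
proof -
  define H where "H = (\<lambda>k. {w \<in> past n b. N (real (grid_index (Suc k) n w) / real (Suc k) + s) w
      = N (real (grid_index (Suc k) n w) / real (Suc k)) w})"
  define H' where "H' = {w \<in> past n b. s < gap n w}"
  have H: "H k \<in> events" "prob (H k) = prob (past n b) * exp (- lam * s)" for k
    unfolding H_def by (intro prob_past_grid s zero_less_Suc)+
  have H': "H' \<in> events" unfolding H'_def by (intro past_Collect_events) measurable
  have conv: "(\<lambda>k. indicator (H k) w :: real) \<longlonglongrightarrow> indicator H' w" if w: "w \<in> space W" "regular w" for w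
  proof -
    define \<tau> where "\<tau> = (\<lambda>k. real (grid_index (Suc k) n w) / real (Suc k))"
    have ge: "hit n w \<le> \<tau> k" and le: "\<tau> k < hit n w + inverse (real (Suc k))" for k
    proof -
      have "0 \<le> hit n w * real (Suc k)" using hit_nonneg by simp
      then have "hit n w * real (Suc k) \<le> real (grid_index (Suc k) n w)"
        "real (grid_index (Suc k) n w) < hit n w * real (Suc k) + 1"
        unfolding grid_index_def by linarith+
      then show "hit n w \<le> \<tau> k" "\<tau> k < hit n w + inverse (real (Suc k))"
        unfolding \<tau>_def by (simp_all add: field_simps del: of_nat_Suc)
    qed
    obtain e where e: "0 < e" "\<And>r. hit n w \<le> r \<Longrightarrow> r < hit n w + e \<Longrightarrow> N r w = N (hit n w) w"
      using N_right_constant[OF w(1) hit_nonneg] by blast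
    have "0 \<le> hit n w + s" using hit_nonneg s by simp
    then obtain e' where e': "0 < e'" "\<And>r. hit n w + s \<le> r \<Longrightarrow> r < hit n w + s + e' \<Longrightarrow> N r w = N (hit n w + s) w"
      using N_right_constant[OF w(1)] by blast
    have "eventually (\<lambda>k. inverse (real (Suc k)) < min e e') sequentially"
      using e(1) e'(1) by (intro order_tendstoD(2)[OF LIMSEQ_inverse_real_of_nat]) auto
    then have "eventually (\<lambda>k. indicator (H k) w = (indicator H' w :: real)) sequentially"
    proof eventually_elim
      case (elim k)
      have "N (\<tau> k) w = n"
        using e(2)[OF ge[of k]] le[of k] elim w by (simp add: regular_def)
      moreover have "N (\<tau> k + s) w = N (hit n w + s) w"
        using e'(2)[of "\<tau> k + s"] ge[of k] le[of k] elim by simp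
      moreover have "n \<le> N (hit n w + s) w"
        using N_mono[OF w(1) hit_nonneg[of n w], of "hit n w + s"] s w(2) by (simp add: regular_def)
      moreover have "s < gap n w \<longleftrightarrow> \<not> Suc n \<le> N (hit n w + s) w"
        using regular_hit_le_iff[OF w \<open>0 \<le> hit n w + s\<close>, of "Suc n"] by (auto simp: gap_def)
      ultimately have "w \<in> H k \<longleftrightarrow> w \<in> H'"
        by (auto simp: H_def H'_def \<tau>_def simp del: of_nat_Suc)
      then show ?case by (simp add: indicator_def)
    qed
    then show ?thesis by (rule tendsto_eventually)
  qed
  have "(\<lambda>k. \<integral>w. indicator (H k) w \<partial>W) \<longlonglongrightarrow> (\<integral>w. indicator H' w \<partial>W :: real)"
  proof (rule integral_dominated_convergence[where w = "\<lambda>_. 1"])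
    show "AE w in W. (\<lambda>k. indicator (H k) w :: real) \<longlonglongrightarrow> indicator H' w"
      using AE_regular AE_space by eventually_elim (rule conv)
  qed (use H H' in \<open>auto simp: indicator_def\<close>)
  then have "(\<lambda>k. prob (H k)) \<longlonglongrightarrow> prob H'"
    using H(1) H' by simp
  then show ?thesis
    unfolding H(2) H'_def by (simp add: LIMSEQ_const_iff)
qed

lemma prob_gap_greater:
  assumes s: "0 \<le> s"
  shows "prob {w \<in> space W. s < gap n w} = exp (- lam * s)"
proof -
  \<comment> \<open>Constant bounds tending to infinity exhaust the space, which removes the
    condition on the past.\<close>
  define b where "b = (\<lambda>k :: nat. \<lambda>i :: nat. real k)"
  have inc: "incseq (\<lambda>k. past n (b k))" "incseq (\<lambda>k. {w \<in> past n (b k). s < gap n w})"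
    by (auto simp: incseq_def past_def b_def intro: order_trans)
  have UN: "(\<Union>k. past n (b k)) = space W"
  proof -
    have "\<exists>k. \<forall>i\<le>n. hit i w \<le> real k" for w
    proof -
      obtain k :: nat where "Max ((\<lambda>i. hit i w) ` {..n}) \<le> real k" using real_arch_simple by blast
      then have "\<forall>i\<le>n. hit i w \<le> real k" by simp
      then show ?thesis by blast
    qed
    then show ?thesis by (auto simp: past_def b_def)
  qed
  then have UN2: "(\<Union>k. {w \<in> past n (b k). s < gap n w}) = {w \<in> space W. s < gap n w}"
    by auto
  have "(\<lambda>k. prob (past n (b k)) * exp (- lam * s)) \<longlonglongrightarrow> 1 * exp (- lam * s)"
    using finite_Lim_measure_incseq[OF _ inc(1)] past_events
    by (intro tendsto_mult tendsto_const) (simp add: UN prob_space image_subset_iff)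
  moreover have "(\<lambda>k. prob {w \<in> past n (b k). s < gap n w}) \<longlonglongrightarrow> prob {w \<in> space W. s < gap n w}"
  proof -
    have "{w \<in> past n (b k). s < gap n w} \<in> events" for k
      by (intro past_Collect_events) measurable
    then show ?thesis
      using finite_Lim_measure_incseq[OF _ inc(2)] by (simp add: UN2 image_subset_iff)
  qed
  ultimately show ?thesis
    using LIMSEQ_unique by (simp add: prob_past_gap[OF s])
qed

lemma gap_exponential: "distributed W lborel (gap n) (exponential_density lam)"
proof (rule exponential_distributedI[OF gap_measurable lam_pos])
  fix a :: real assume "0 \<le> a"
  have "{w \<in> space W. gap n w \<le> a} = space W - {w \<in> space W. a < gap n w}" by auto
  moreover have "{w \<in> space W. a < gap n w} \<in> events" by measurable
  ultimately show "emeasure W {w \<in> space W. gap n w \<le> a} = 1 - ennreal (exp (- a * lam))"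
    using prob_gap_greater[OF \<open>0 \<le> a\<close>, of n]
    by (simp add: emeasure_eq_measure prob_compl mult.commute ennreal_minus flip: ennreal_1)
qed

section \<open>Independence of an interarrival time from the past\<close>

definition past_algebra :: "nat \<Rightarrow> 'w measure" where
  "past_algebra n = sigma (space W) (range (past n))"

lemma space_past_algebra [simp]: "space (past_algebra n) = space W"
  unfolding past_algebra_def by (rule space_measure_of) (auto simp: past_def)

lemma sets_past_algebra: "sets (past_algebra n) = sigma_sets (space W) (range (past n))"
  unfolding past_algebra_def by (rule sets_measure_of) (auto simp: past_def)

lemma hit_measurable_past_algebra:
  assumes "i \<le> n"
  shows "hit i \<in> borel_measurable (past_algebra n)"
proof (rule borel_measurable_iff_le[THEN iffD2], intro allI)
  fix a
  \<comment> \<open>The bounds at the other indices are sent to infinity through the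
    integers.\<close>
  have "{w \<in> space (past_algebra n). hit i w \<le> a} = (\<Union>k. past n (\<lambda>j. if j = i then a else real k))"
  proof (intro equalityI subsetI)
    fix w assume w: "w \<in> {w \<in> space (past_algebra n). hit i w \<le> a}"
    obtain k :: nat where "Max ((\<lambda>i. hit i w) ` {..n}) \<le> real k" using real_arch_simple by blast
    then have "\<forall>i\<le>n. hit i w \<le> real k" by simp
    with w show "w \<in> (\<Union>k. past n (\<lambda>j. if j = i then a else real k))" by (auto simp: past_def)
  qed (use assms in \<open>auto simp: past_def split: if_splits\<close>)
  also have "\<dots> \<in> sets (past_algebra n)"
    unfolding sets_past_algebra by (intro sigma_sets_UNION) (auto intro: sigma_sets.Basic)
  finally show "{w \<in> space (past_algebra n). hit i w \<le> a} \<in> sets (past_algebra n)" .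
qed

lemma gap_measurable_past_algebra: "i < n \<Longrightarrow> gap i \<in> borel_measurable (past_algebra n)"
  unfolding gap_def by (intro borel_measurable_diff hit_measurable_past_algebra) auto

text \<open>Both generators are stable under intersection, so the product formula for one event
  \<open>past n b\<close> and one tail event of the gap is enough. For \<open>0 \<le> s\<close> it
  is \<open>prob_past_gap\<close>; for negative \<open>s\<close> the tail event has probability one
  because jump times increase strictly.\<close>

lemma indep_set_past_gap:
  "indep_set (sets (past_algebra n)) (sigma_sets (space W) (range (\<lambda>s. {w \<in> space W. s < gap n w})))"
  unfolding sets_past_algebra
proof (rule indep_set_sigma_sets)
  show "Int_stable (range (past n))"
  proof (rule Int_stableI_image)
    fix b b'
    show "\<exists>k\<in>UNIV. past n b \<inter> past n b' = past n k"
      by (intro bexI[of _ "\<lambda>i. min (b i) (b' i)"]) (auto simp: past_def)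
  qed
  show "Int_stable (range (\<lambda>s. {w \<in> space W. s < gap n w}))"
  proof (rule Int_stableI_image)
    fix s t :: real
    show "\<exists>k\<in>UNIV. {w \<in> space W. s < gap n w} \<inter> {w \<in> space W. t < gap n w} = {w \<in> space W. k < gap n w}"
      by (intro bexI[of _ "max s t"]) auto
  qed
  have ev: "{w \<in> space W. s < gap n w} \<in> events" for s by measurable
  have "prob (past n b \<inter> {w \<in> space W. s < gap n w}) = prob (past n b) * prob {w \<in> space W. s < gap n w}" for b s
  proof (cases "0 \<le> s")
    case True
    have "past n b \<inter> {w \<in> space W. s < gap n w} = {w \<in> past n b. s < gap n w}"
      by (auto simp: past_def)
    then show ?thesis using prob_past_gap[OF True] prob_gap_greater[OF True] by simp
  next
    case False
    have "AE w in W. s < gap n w"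
      using AE_regular AE_space
    proof eventually_elim
      case (elim w)
      then show ?case using regular_hit_strict_mono[of w n] False by (simp add: gap_def)
    qed
    then have "prob {w \<in> space W. s < gap n w} = 1"
      using prob_Collect_eq_1[of "\<lambda>w. s < gap n w"] ev by simp
    moreover have "prob (past n b \<inter> {w \<in> space W. s < gap n w}) = prob (past n b)"
      by (rule measure_eq_AE) (use \<open>AE w in W. s < gap n w\<close> ev in \<open>auto intro: AE_mp simp: past_def\<close>)
    ultimately show ?thesis by simp
  qed
  then show "indep_set (range (past n)) (range (\<lambda>s. {w \<in> space W. s < gap n w}))"
    unfolding indep_sets2_eq using ev by auto
qed

lemma distr_past_gap:
  assumes Z: "Z \<in> measurable (past_algebra n) S"
  shows "Z \<in> measurable W S"
    and "distr W S Z \<Otimes>\<^sub>M distr W borel (gap n) = distr W (S \<Otimes>\<^sub>M borel) (\<lambda>w. (Z w, gap n w))"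
proof -
  have sub: "sets (past_algebra n) \<subseteq> events"
    using indep_set_past_gap[of n] unfolding indep_sets2_eq by blast
  show Zm [measurable]: "Z \<in> measurable W S"
    using Z sub unfolding measurable_def by auto
  define G where "G = sigma (space W) (range (\<lambda>s. {w \<in> space W. s < gap n w}))"
  have spG: "space G = space W" unfolding G_def by (rule space_measure_of) auto
  have setsG: "sets G = sigma_sets (space W) (range (\<lambda>s. {w \<in> space W. s < gap n w}))"
    unfolding G_def by (rule sets_measure_of) auto
  have gapG: "gap n \<in> borel_measurable G"
    by (rule borel_measurable_iff_greater[THEN iffD2]) (auto simp: spG setsG intro: sigma_sets.Basic)
  interpret Z: prob_space "distr W S Z" by (rule prob_space_distr[OF Zm])
  interpret G: prob_space "distr W borel (gap n)" by (rule prob_space_distr[OF gap_measurable])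
  show "distr W S Z \<Otimes>\<^sub>M distr W borel (gap n) = distr W (S \<Otimes>\<^sub>M borel) (\<lambda>w. (Z w, gap n w))"
  proof (rule pair_measure_eqI)
    show "sets (distr W S Z \<Otimes>\<^sub>M distr W borel (gap n)) = sets (distr W (S \<Otimes>\<^sub>M borel) (\<lambda>w. (Z w, gap n w)))"
      by (simp cong: sets_pair_measure_cong)
    fix A B assume "A \<in> sets (distr W S Z)" "B \<in> sets (distr W borel (gap n))"
    then have A [measurable]: "A \<in> sets S" and B [measurable]: "B \<in> sets borel" by auto
    have "prob ((Z -` A \<inter> space W) \<inter> (gap n -` B \<inter> space W)) = prob (Z -` A \<inter> space W) * prob (gap n -` B \<inter> space W)"
      using indep_set_past_gap[of n] measurable_sets[OF Z A] measurable_sets[OF gapG B]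
      unfolding indep_sets2_eq by (simp add: spG setsG)
    moreover have "(\<lambda>w. (Z w, gap n w)) -` (A \<times> B) \<inter> space W = (Z -` A \<inter> space W) \<inter> (gap n -` B \<inter> space W)"
      by auto
    ultimately show "emeasure (distr W S Z) A * emeasure (distr W borel (gap n)) B
      = emeasure (distr W (S \<Otimes>\<^sub>M borel) (\<lambda>w. (Z w, gap n w))) (A \<times> B)"
      by (simp add: emeasure_distr emeasure_eq_measure ennreal_mult'')
  qed (unfold_locales)
qed

text \<open>Independence used as an iterated integral: with the past frozen in \<open>Z\<close>, the
  next gap is averaged over its exponential law. This replaces conditional expectations
  throughout.\<close>

lemma nn_integral_past_gap:
  assumes Z: "Z \<in> measurable (past_algebra n) S"
    and k: "k \<in> borel_measurable (S \<Otimes>\<^sub>M borel)"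
  shows "(\<integral>\<^sup>+ w. k (Z w, gap n w) \<partial>W) =
    (\<integral>\<^sup>+ w. (\<integral>\<^sup>+ x. k (Z w, x) \<partial>density lborel (exponential_density lam)) \<partial>W)"
proof -
  note [measurable] = distr_past_gap(1)[OF Z]
  note eq = distr_past_gap(2)[OF Z]
  interpret G: prob_space "distr W borel (gap n)" by (rule prob_space_distr) measurable
  have dist: "distr W borel (gap n) = density lborel (\<lambda>x. ennreal (exponential_density lam x))"
    using distributed_distr_eq_density[OF gap_exponential[of n]] by (simp cong: distr_cong)
  have k': "k \<in> borel_measurable (distr W S Z \<Otimes>\<^sub>M distr W borel (gap n))"
    using k by (simp cong: measurable_cong_sets)
  have [measurable]: "k \<in> borel_measurable (S \<Otimes>\<^sub>M borel)" by (rule k)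
  have "(\<integral>\<^sup>+ w. k (Z w, gap n w) \<partial>W) = (\<integral>\<^sup>+ z. k z \<partial>distr W (S \<Otimes>\<^sub>M borel) (\<lambda>w. (Z w, gap n w)))"
    by (subst nn_integral_distr) auto
  also have "\<dots> = (\<integral>\<^sup>+ y. (\<integral>\<^sup>+ x. k (y, x) \<partial>distr W borel (gap n)) \<partial>distr W S Z)"
    unfolding eq[symmetric] by (rule G.nn_integral_fst[OF k', symmetric])
  also have "\<dots> = (\<integral>\<^sup>+ w. (\<integral>\<^sup>+ x. k (Z w, x) \<partial>distr W borel (gap n)) \<partial>W)"
  proof -
    have "(\<lambda>y. \<integral>\<^sup>+ x. k (y, x) \<partial>distr W borel (gap n)) \<in> borel_measurable S"
      using k by (intro G.borel_measurable_nn_integral) (simp cong: measurable_cong_sets)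
    then show ?thesis by (subst nn_integral_distr) simp_all
  qed
  finally show ?thesis unfolding dist .
qed

end

section \<open>The mean escape time as a series\<close>

lemma borel_measurable_riccati_flow2 [measurable (raw)]:
  fixes C :: "real^('k::finite + 'm::finite)^('k + 'm)"
  assumes [measurable]: "f \<in> borel_measurable M" "g \<in> borel_measurable M"
  shows "(\<lambda>x. riccati_flow C (f x) (g x)) \<in> borel_measurable M"
proof -
  have "(\<lambda>x. (f x, g x)) \<in> measurable M borel" by (intro borel_measurable_Pair assms)
  from measurable_compose[OF this borel_measurable_riccati_flow] show ?thesis by simp
qed

lemma borel_measurable_active_escape [measurable]:
  "active_escape A B c \<in> borel_measurable borel"
  unfolding active_escape_def by measurable

text \<open>
  \<open>switch_op\<close> and \<open>switch_mean\<close> are the operators \<open>M\<^sub>1, M\<^sub>2\<close> and the functions \<open>g\<^sub>1, g\<^sub>2\<close> for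
  extended nonnegative functions, with \<open>A\<close> active if the flag is \<open>True\<close> and \<open>B\<close> otherwise.
\<close>

definition switch_op ::
  "real \<Rightarrow> real^('k::finite + 'm::finite)^('k + 'm) \<Rightarrow> real^('k + 'm)^('k + 'm) \<Rightarrow>
   (bool \<Rightarrow> real^'k^'m \<Rightarrow> ennreal) \<Rightarrow> bool \<Rightarrow> real^'k^'m \<Rightarrow> ennreal" where
  "switch_op lam A B h c Y = (\<integral>\<^sup>+ x. of_bool (x < active_escape A B c Y) *
     h (\<not> c) (riccati_flow (if c then A else B) x Y) \<partial>density lborel (exponential_density lam))"

definition switch_mean ::
  "real \<Rightarrow> real^('k::finite + 'm::finite)^('k + 'm) \<Rightarrow> real^('k + 'm)^('k + 'm) \<Rightarrow>
   bool \<Rightarrow> real^'k^'m \<Rightarrow> ennreal" where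
  "switch_mean lam A B c Y = (\<integral>\<^sup>+ x. ennreal (min x (active_escape A B c Y))
     \<partial>density lborel (exponential_density lam))"

lemma sigma_finite_exponential: "0 < lam \<Longrightarrow> sigma_finite_measure (density lborel (exponential_density lam))"
  using prob_space_exponential_density[of lam] by (rule prob_space_imp_sigma_finite)

lemma borel_measurable_switch_op:
  assumes "0 < lam" and [measurable]: "\<And>c. h c \<in> borel_measurable borel"
  shows "switch_op lam A B h c \<in> borel_measurable borel"
proof -
  interpret sigma_finite_measure "density lborel (exponential_density lam)"
    by (rule sigma_finite_exponential) fact
  have "(\<lambda>(Y, x). of_bool (x < active_escape A B c Y) * h (\<not> c) (riccati_flow (if c then A else B) x Y))
    \<in> borel_measurable (borel \<Otimes>\<^sub>M density lborel (exponential_density lam))"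
    by measurable
  from borel_measurable_nn_integral[OF this] show ?thesis
    unfolding switch_op_def .
qed

lemma borel_measurable_switch_mean:
  assumes "0 < lam"
  shows "switch_mean lam A B c \<in> borel_measurable borel"
proof -
  interpret sigma_finite_measure "density lborel (exponential_density lam)"
    by (rule sigma_finite_exponential) fact
  have "(\<lambda>(Y, x). ennreal (min x (active_escape A B c Y)))
    \<in> borel_measurable (borel \<Otimes>\<^sub>M density lborel (exponential_density lam))"
    by measurable
  from borel_measurable_nn_integral[OF this] show ?thesis
    unfolding switch_mean_def .
qed

lemma borel_measurable_switch_op_funpow:
  assumes "0 < lam"
  shows "(switch_op lam A B ^^ n) (switch_mean lam A B) c \<in> borel_measurable borel"
proof (induction n arbitrary: c)
  case 0
  then show ?case using borel_measurable_switch_mean[OF assms] by simp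
next
  case (Suc n)
  then show ?case using borel_measurable_switch_op[OF assms, of "(switch_op lam A B ^^ n) (switch_mean lam A B)"] by simp
qed

section \<open>Conditioning on one period after the other\<close>

context poisson
begin

text \<open>The state number \<open>i\<close> is a function of the gaps before \<open>i\<close>,
  hence of the jump times up to \<open>i\<close>. The separate bound \<open>n\<close> keeps the
  algebra fixed during the induction.\<close>

lemma switch_state_measurable:
  fixes A B :: "real^('k::finite + 'm::finite)^('k + 'm)"
  shows "i \<le> n \<Longrightarrow> (\<lambda>w. switch_state A B c Y (\<lambda>i. gap i w) i) \<in> borel_measurable (past_algebra n)"
proof (induction i)
  case (Suc i)
  have [measurable]: "gap i \<in> borel_measurable (past_algebra n)"
    using Suc by (intro gap_measurable_past_algebra) auto
  have [measurable]: "(\<lambda>w. switch_state A B c Y (\<lambda>i. gap i w) i) \<in> borel_measurable (past_algebra n)"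
    using Suc by auto
  show ?case by simp
qed simp

lemma survives_measurable:
  fixes A B :: "real^('k::finite + 'm::finite)^('k + 'm)"
  shows "i \<le> n \<Longrightarrow> (\<lambda>w. survives A B c Y (\<lambda>i. gap i w) i) \<in> measurable (past_algebra n) (count_space UNIV)"
proof (induction i)
  case (Suc i)
  have [measurable]: "gap i \<in> borel_measurable (past_algebra n)"
    using Suc by (intro gap_measurable_past_algebra) auto
  have [measurable]: "(\<lambda>w. switch_state A B c Y (\<lambda>i. gap i w) i) \<in> borel_measurable (past_algebra n)"
    using Suc by (intro switch_state_measurable) auto
  have [measurable]: "(\<lambda>w. survives A B c Y (\<lambda>i. gap i w) i) \<in> measurable (past_algebra n) (count_space UNIV)"
    using Suc by auto
  show ?case unfolding survives_Suc by measurable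
qed simp

lemma state_measurable:
  fixes A B :: "real^('k::finite + 'm::finite)^('k + 'm)"
  shows "(\<lambda>w. (survives A B c Y (\<lambda>i. gap i w) n, switch_state A B c Y (\<lambda>i. gap i w) n))
    \<in> measurable (past_algebra n) (count_space UNIV \<Otimes>\<^sub>M borel)"
  by (intro measurable_Pair survives_measurable switch_state_measurable order_refl)

text \<open>Survival of the first \<open>n\<close> periods and the state after them belong to the
  past, so only \<open>k\<close> is averaged over the new gap.\<close>

lemma nn_integral_next_period:
  fixes A B :: "real^('k::finite + 'm::finite)^('k + 'm)"
  assumes k: "(\<lambda>(y, x). k y x) \<in> borel_measurable (borel \<Otimes>\<^sub>M borel)"
  shows "(\<integral>\<^sup>+ w. of_bool (survives A B c Y (\<lambda>i. gap i w) n) * k (switch_state A B c Y (\<lambda>i. gap i w) n) (gap n w) \<partial>W)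
    = (\<integral>\<^sup>+ w. of_bool (survives A B c Y (\<lambda>i. gap i w) n) *
        (\<integral>\<^sup>+ x. k (switch_state A B c Y (\<lambda>i. gap i w) n) x \<partial>density lborel (exponential_density lam)) \<partial>W)"
proof -
  have kk: "(\<lambda>((s, y), x). of_bool s * k y x) \<in> borel_measurable ((count_space UNIV \<Otimes>\<^sub>M borel) \<Otimes>\<^sub>M borel)"
  proof -
    have "(\<lambda>z :: (bool \<times> (real^'k^'m)) \<times> real. (snd (fst z), snd z)) \<in> measurable ((count_space UNIV \<Otimes>\<^sub>M borel) \<Otimes>\<^sub>M borel) (borel \<Otimes>\<^sub>M borel)"
      by measurable
    from measurable_compose[OF this k] have [measurable]:
      "(\<lambda>z. k (snd (fst z)) (snd z)) \<in> borel_measurable ((count_space (UNIV :: bool set) \<Otimes>\<^sub>M borel) \<Otimes>\<^sub>M borel)"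
      by (simp add: split_beta')
    show ?thesis unfolding split_beta' by measurable
  qed
  have "(\<integral>\<^sup>+ x. of_bool s * k y x \<partial>density lborel (exponential_density lam))
    = of_bool s * (\<integral>\<^sup>+ x. k y x \<partial>density lborel (exponential_density lam))" for s y
    by (cases s) auto
  then show ?thesis
    using nn_integral_past_gap[OF state_measurable kk, of A B c Y n] by simp
qed

text \<open>The last period is averaged first and turns \<open>h\<close> into
  \<open>switch_op lam A B h\<close>; the induction therefore runs over all \<open>h\<close>
  simultaneously.\<close>

lemma nn_integral_survives:
  fixes A B :: "real^('k::finite + 'm::finite)^('k + 'm)"
  assumes [measurable]: "\<And>c. h c \<in> borel_measurable borel"
  shows "(\<integral>\<^sup>+ w. of_bool (survives A B c Y (\<lambda>i. gap i w) n) * h (phase c n) (switch_state A B c Y (\<lambda>i. gap i w) n) \<partial>W)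
    = (switch_op lam A B ^^ n) h c Y"
  using assms
proof (induction n arbitrary: h)
  case 0
  then show ?case by (simp add: emeasure_space_1)
next
  case (Suc n)
  note [measurable] = Suc.prems
  define p where "p = phase c n"
  define k where "k = (\<lambda>y x. of_bool (x < active_escape A B p y) * h (\<not> p) (riccati_flow (if p then A else B) x y))"
  have "(\<integral>\<^sup>+ w. of_bool (survives A B c Y (\<lambda>i. gap i w) (Suc n)) * h (phase c (Suc n)) (switch_state A B c Y (\<lambda>i. gap i w) (Suc n)) \<partial>W)
    = (\<integral>\<^sup>+ w. of_bool (survives A B c Y (\<lambda>i. gap i w) n) * k (switch_state A B c Y (\<lambda>i. gap i w) n) (gap n w) \<partial>W)"
    by (intro nn_integral_cong) (auto simp: survives_Suc k_def p_def)
  also have "\<dots> = (\<integral>\<^sup>+ w. of_bool (survives A B c Y (\<lambda>i. gap i w) n) *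
        (\<integral>\<^sup>+ x. k (switch_state A B c Y (\<lambda>i. gap i w) n) x \<partial>density lborel (exponential_density lam)) \<partial>W)"
    by (rule nn_integral_next_period) (unfold k_def, measurable)
  also have "\<dots> = (\<integral>\<^sup>+ w. of_bool (survives A B c Y (\<lambda>i. gap i w) n) *
        switch_op lam A B h (phase c n) (switch_state A B c Y (\<lambda>i. gap i w) n) \<partial>W)"
    by (simp add: switch_op_def k_def p_def)
  also have "\<dots> = (switch_op lam A B ^^ n) (switch_op lam A B h) c Y"
    by (rule Suc.IH) (rule borel_measurable_switch_op[OF lam_pos Suc.prems])
  finally show ?case by (simp add: funpow_swap1)
qed

lemma nn_integral_period:
  fixes A B :: "real^('k::finite + 'm::finite)^('k + 'm)"
  shows "(\<integral>\<^sup>+ w. of_bool (survives A B c Y (\<lambda>i. gap i w) n) *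
      ennreal (min (gap n w) (active_escape A B (phase c n) (switch_state A B c Y (\<lambda>i. gap i w) n))) \<partial>W)
    = (switch_op lam A B ^^ n) (switch_mean lam A B) c Y"
proof -
  have "(\<integral>\<^sup>+ w. of_bool (survives A B c Y (\<lambda>i. gap i w) n) *
      ennreal (min (gap n w) (active_escape A B (phase c n) (switch_state A B c Y (\<lambda>i. gap i w) n))) \<partial>W)
    = (\<integral>\<^sup>+ w. of_bool (survives A B c Y (\<lambda>i. gap i w) n) *
      switch_mean lam A B (phase c n) (switch_state A B c Y (\<lambda>i. gap i w) n) \<partial>W)"
    unfolding switch_mean_def by (rule nn_integral_next_period) measurable
  also have "\<dots> = (switch_op lam A B ^^ n) (switch_mean lam A B) c Y"
    by (rule nn_integral_survives) (rule borel_measurable_switch_mean[OF lam_pos])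
  finally show ?thesis .
qed

lemma past_algebra_subset: "sets (past_algebra n) \<subseteq> events"
  using indep_set_past_gap[of n] unfolding indep_sets2_eq by blast

lemma AE_switched_escape_time:
  fixes A B :: "real^('k::finite + 'm::finite)^('k + 'm)"
  assumes z: "AE w in W. z 0 w = of_bool c \<and> switching_path (\<lambda>t. N t w) (\<lambda>t. z t w)"
    and fin: "\<And>c Y. rde_escape_time (if c then A else B) (Y :: real^'k^'m) < \<infinity>"
  shows "AE w in W. e2ennreal (switched_escape_time A B (\<lambda>t. z t w) Y) =
    (\<Sum>n. of_bool (survives A B c Y (\<lambda>i. gap i w) n) *
      ennreal (min (gap n w) (active_escape A B (phase c n) (switch_state A B c Y (\<lambda>i. gap i w) n))))"
  using z AE_regular AE_space
proof eventually_elim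
  case (elim w)
  note hit = hit_0[OF elim(3)] regular_hit_strict_mono[OF elim(3,2)]
  show ?case
  proof (rule switched_escape_time_suminf[where S = "\<lambda>n. hit n w"])
    show "\<exists>n. t < hit n w" for t by (rule regular_hit_unbounded[OF elim(3,2)])
    show "z t w = of_bool (phase c n)" if "hit n w \<le> t" "t < hit (Suc n) w" for n t
      by (rule switching_path_phase[where S = "\<lambda>n. hit n w" and p = "\<lambda>t. N t w"])
        (use elim hit that regular_hit_le_iff[OF elim(3,2)] in auto)
  qed (use hit fin in \<open>auto simp: gap_def\<close>)
qed

lemma period_measurable:
  fixes A B :: "real^('k::finite + 'm::finite)^('k + 'm)"
  shows "(\<lambda>w. of_bool (survives A B c Y (\<lambda>i. gap i w) n) *
      ennreal (min (gap n w) (active_escape A B (phase c n) (switch_state A B c Y (\<lambda>i. gap i w) n))))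
    \<in> borel_measurable W"
proof -
  have sub: "f \<in> measurable W M" if "f \<in> measurable (past_algebra n) M" for f :: "'w \<Rightarrow> 'c" and M
    using that past_algebra_subset[of n] unfolding measurable_def by auto
  have [measurable]: "(\<lambda>w. switch_state A B c Y (\<lambda>i. gap i w) n) \<in> borel_measurable W"
    by (rule sub[OF switch_state_measurable[OF order_refl]])
  have [measurable]: "(\<lambda>w. survives A B c Y (\<lambda>i. gap i w) n) \<in> measurable W (count_space UNIV)"
    by (rule sub[OF survives_measurable[OF order_refl]])
  show ?thesis by measurable
qed

lemma mean_escape_time_suminf:
  fixes A B :: "real^('k::finite + 'm::finite)^('k + 'm)"
  assumes z: "AE w in W. z 0 w = of_bool c \<and> switching_path (\<lambda>t. N t w) (\<lambda>t. z t w)"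
    and fin: "\<And>c Y. rde_escape_time (if c then A else B) (Y :: real^'k^'m) < \<infinity>"
  shows "mean_escape_time W A B z Y = (\<Sum>n. (switch_op lam A B ^^ n) (switch_mean lam A B) c Y)"
  unfolding mean_escape_time_def nn_integral_cong_AE[OF AE_switched_escape_time[OF z fin]]
  by (subst nn_integral_suminf[OF period_measurable]) (simp add: nn_integral_period)

text \<open>The switching paths are prescribed almost everywhere only, so the escape time agrees
  with the measurable series \<open>g\<close> off a null set; completeness of the measure turns this
  into measurability.\<close>

lemma switched_escape_time_measurable:
  fixes A B :: "real^('k::finite + 'm::finite)^('k + 'm)"
  assumes z: "AE w in W. z 0 w = of_bool c \<and> switching_path (\<lambda>t. N t w) (\<lambda>t. z t w)"
    and fin: "\<And>c Y. rde_escape_time (if c then A else B) (Y :: real^'k^'m) < \<infinity>"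
  shows "(\<lambda>w. switched_escape_time A B (\<lambda>t. z t w) Y) \<in> borel_measurable (completion W)"
proof -
  define f where "f = (\<lambda>w. switched_escape_time A B (\<lambda>t. z t w) Y)"
  define g where "g = (\<lambda>w. enn2ereal (\<Sum>n. of_bool (survives A B c Y (\<lambda>i. gap i w) n) *
      ennreal (min (gap n w) (active_escape A B (phase c n) (switch_state A B c Y (\<lambda>i. gap i w) n)))))"
  have g: "g \<in> borel_measurable W"
    unfolding g_def using period_measurable by measurable
  have "AE w in W. f w = g w"
    using AE_switched_escape_time[OF z fin, of Y]
  proof eventually_elim
    case (elim w)
    then show ?case
      using enn2ereal_e2ennreal[OF switched_escape_time_nonneg[of A B "\<lambda>t. z t w" Y]]
      unfolding f_def g_def elim[symmetric] by simp
  qed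
  then have ae: "AE w in completion W. f w = g w" by (rule AE_completion)
  show ?thesis
    unfolding f_def[symmetric]
  proof (rule measurableI)
    fix S :: "ereal set" assume "S \<in> sets borel"
    then have mem: "g -` S \<inter> space W \<in> sets (completion W)"
      using measurable_sets[OF g] by (auto intro: sets_completionI_sets)
    have "AE w in completion W. w \<in> g -` S \<inter> space W \<longleftrightarrow> w \<in> f -` S \<inter> space (completion W)"
      using ae AE_space by eventually_elim auto
    from completion.in_sets_AE[OF this mem] show "f -` S \<inter> space (completion W) \<in> sets (completion W)"
      by simp
  qed simp
qed

end

section \<open>From exponential expectations to the real functions g and operators M\<close>

lemma interval_integral_exp_density:
  fixes T :: "real \<Rightarrow> real"
  assumes lam: "0 < lam" and e: "0 < e" and T: "(\<lambda>s. indicator {0<..<e} s * T s) \<in> borel_measurable borel"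
  shows "(LINT s=0..ereal e|lebesgue. (exp_density lam s * T s)) =
    (LINT s|density lborel (exponential_density lam). indicator {0<..<e} s * T s)"
proof -
  define U where "U = (\<lambda>s. indicator {0<..<e} s * T s)"
  have U [measurable]: "U \<in> borel_measurable borel" using T by (simp add: U_def)
  have "einterval 0 (ereal e) = {0<..<e}" by (auto simp: einterval_def)
  \<comment> \<open>\<open>exponential_density\<close> vanishes at negative times and
    \<open>exp_density\<close> does not; they agree on the open interval, to which both sides are
    confined.\<close>
  then have pointwise: "indicator (einterval 0 (ereal e)) s *\<^sub>R (exp_density lam s * T s) = exponential_density lam s * U s" for s
    by (auto simp: U_def indicator_def exp_density_def exponential_density_def mult_ac)
  have "(LINT s=0..ereal e|lebesgue. (exp_density lam s * T s)) = (LINT s|lebesgue. exponential_density lam s * U s)"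
    using e unfolding interval_lebesgue_integral_def set_lebesgue_integral_def pointwise
    by (simp add: zero_ereal_def)
  also have "\<dots> = (LINT s|lborel. exponential_density lam s * U s)"
    by (rule integral_completion) measurable
  also have "\<dots> = (LINT s|density lborel (exponential_density lam). U s)"
    using lam by (subst integral_density) (auto simp: exponential_density_def)
  finally show ?thesis by (simp add: U_def)
qed

lemma AE_exponential_pos:
  assumes "0 < lam"
  shows "AE x in density lborel (exponential_density lam). 0 < x"
proof -
  have "AE x in lborel. x \<noteq> (0 :: real)" by (rule AE_lborel_singleton)
  then have "AE x in lborel. 0 < ennreal (exponential_density lam x) \<longrightarrow> 0 < x"
    by eventually_elim (auto simp: exponential_density_def)
  then show ?thesis by (subst AE_density) auto
qed

locale bounded_escape =
  fixes A B :: "real^('k::finite + 'm::finite)^('k + 'm)" and lam t0 :: real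
  assumes lam: "0 < lam"
    and escape_le: "\<And>c Y. rde_escape_time (if c then A else B) Y \<le> ereal t0"
begin

lemma rde_escape_time_eq: "rde_escape_time (if c then A else B) Y = ereal (active_escape A B c Y)"
  using escape_le[of c Y] rde_escape_time_pos[of "if c then A else B" Y]
  by (cases "rde_escape_time (if c then A else B) Y") (auto simp: active_escape_def)

lemma active_escape_pos: "0 < active_escape A B c Y"
  using rde_escape_time_pos[of "if c then A else B" Y] unfolding rde_escape_time_eq by simp

lemma active_escape_le: "active_escape A B c Y \<le> t0"
  using escape_le[of c Y] unfolding rde_escape_time_eq by simp

lemma t0_pos: "0 < t0"
  using active_escape_pos[of True "0 :: real^'k^'m"] active_escape_le[of True "0 :: real^'k^'m"] by linarith

abbreviation "expd \<equiv> density lborel (\<lambda>x. ennreal (exponential_density lam x))"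

lemma prob_space_expd: "prob_space expd"
  by (rule prob_space_exponential_density[OF lam])

definition rate :: real where "rate = 1 - exp (- lam * t0)"

lemma rate: "0 \<le> rate" "rate < 1"
  using lam t0_pos by (auto simp: rate_def)

lemma switch_mean_le: "switch_mean lam A B c Y \<le> ennreal t0"
proof -
  interpret prob_space expd by (rule prob_space_expd)
  have "switch_mean lam A B c Y \<le> (\<integral>\<^sup>+ x. ennreal t0 \<partial>expd)"
    unfolding switch_mean_def using active_escape_le[of c Y]
    by (intro nn_integral_mono ennreal_leI) (auto simp: min_def intro: order_trans)
  then show ?thesis by (simp only: nn_integral_const emeasure_space_1) simp
qed

text \<open>A switch before the escape takes place before \<open>t0\<close>, an event whose
  probability is at most \<open>rate\<close> whatever the current state is.\<close>

lemma switch_op_le: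
  assumes "\<And>c Y. h c Y \<le> ennreal b" "0 \<le> b"
  shows "switch_op lam A B h c Y \<le> ennreal (rate * b)"
proof -
  have "switch_op lam A B h c Y \<le> (\<integral>\<^sup>+ x. ennreal b * indicator {..t0} x \<partial>expd)"
    unfolding switch_op_def
  proof (rule nn_integral_mono)
    fix x
    have "h (\<not> c) (riccati_flow (if c then A else B) x Y) \<le> ennreal b" by (rule assms(1))
    then show "of_bool (x < active_escape A B c Y) * h (\<not> c) (riccati_flow (if c then A else B) x Y)
      \<le> ennreal b * indicator {..t0} x"
      using active_escape_le[of c Y] by (auto simp: indicator_def)
  qed
  also have "\<dots> = ennreal b * emeasure expd {..t0}"
    by (rule nn_integral_cmult_indicator) simp
  also have "emeasure expd {..t0} = ennreal rate"
    using lam t0_pos by (subst emeasure_erlang_density) (auto simp: erlang_CDF_0 rate_def)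
  finally show ?thesis
    using rate assms(2) by (simp add: ennreal_mult'[symmetric] mult.commute)
qed

lemma funpow_switch_op_le: "(switch_op lam A B ^^ n) (switch_mean lam A B) c Y \<le> ennreal (rate ^ n * t0)"
proof (induction n arbitrary: c Y)
  case 0
  then show ?case using switch_mean_le by simp
next
  case (Suc n)
  then show ?case
    using switch_op_le[of "(switch_op lam A B ^^ n) (switch_mean lam A B)" "rate ^ n * t0" c Y] rate(1) t0_pos
    by (simp add: mult.assoc)
qed

text \<open>Both sides are the mean of the minimum of an exponential time and the escape time
  \<open>e\<close>: times below \<open>e\<close> contribute themselves, the others contribute
  \<open>e\<close> with total weight \<open>1 - exp_cdf lam e\<close>.\<close>

lemma riccati_g_eq: "riccati_g lam (if c then A else B) Y = enn2real (switch_mean lam A B c Y)"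
proof -
  interpret prob_space expd by (rule prob_space_expd)
  define e where "e = active_escape A B c Y"
  have e: "0 < e" by (simp add: e_def active_escape_pos)
  have 1: "(LINT s=0..ereal e|lebesgue. (s * exp_density lam s)) = (LINT s|expd. indicator {0<..<e} s * s)"
    using interval_integral_exp_density[OF lam e, of "\<lambda>s. s"] by (simp add: mult.commute)
  have 2: "exp_cdf lam e = (LINT s|expd. indicator {0<..<e} s)"
    using interval_integral_exp_density[OF lam e, of "\<lambda>s. 1"] by (simp add: exp_cdf_def)
  have i1: "integrable expd (\<lambda>s. indicator {0<..<e} s * s)"
    by (rule integrable_const_bound[where B = e]) (use e in \<open>auto simp: indicator_def\<close>)
  have i2: "integrable expd (\<lambda>s. indicator {0<..<e} s :: real)"
    by (rule integrable_const_bound[where B = 1]) auto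
  have "riccati_g lam (if c then A else B) Y =
      (LINT s|expd. indicator {0<..<e} s * s) + e * (1 - (LINT s|expd. indicator {0<..<e} s))"
    unfolding riccati_g_def rde_escape_time_eq e_def[symmetric] by (simp only: 1 2 real_of_ereal.simps)
  also have "\<dots> = (LINT s|expd. indicator {0<..<e} s * s + e * (1 - indicator {0<..<e} s))"
    using i1 i2 prob_space by simp
  also have "\<dots> = (LINT s|expd. min s e)"
  proof (rule integral_cong_AE)
    show "AE s in expd. indicator {0<..<e} s * s + e * (1 - indicator {0<..<e} s) = min s e"
      using AE_exponential_pos[OF lam] by eventually_elim (auto simp: indicator_def min_def)
  qed measurable
  also have "\<dots> = enn2real (\<integral>\<^sup>+ s. ennreal (min s e) \<partial>expd)"
  proof (rule integral_eq_nn_integral)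
    show "AE s in expd. 0 \<le> min s e"
      using AE_exponential_pos[OF lam] by eventually_elim (use e in auto)
  qed measurable
  finally show ?thesis by (simp add: switch_mean_def e_def)
qed

text \<open>Finiteness of \<open>h\<close> matters since \<open>enn2real\<close> would send an
  infinite value to \<open>0\<close>. The integral runs over times strictly before the escape, where
  \<open>rde_flow\<close> may be exchanged for the Borel function
  \<open>riccati_flow\<close>.\<close>

lemma riccati_M_eq:
  assumes h: "h (\<not> c) \<in> borel_measurable borel" "\<And>Y. h (\<not> c) Y < \<top>"
  shows "riccati_M lam (if c then A else B) (\<lambda>X. enn2real (h (\<not> c) X)) Y = enn2real (switch_op lam A B h c Y)"
proof -
  note [measurable] = h(1)
  define C where "C = (if c then A else B)"
  define e where "e = active_escape A B c Y"
  have e: "0 < e" by (simp add: e_def active_escape_pos)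
  have E: "rde_escape_time C Y = ereal e" by (simp add: C_def e_def rde_escape_time_eq)
  have eq: "indicator {0<..<e} s * enn2real (h (\<not> c) (rde_flow C s Y))
    = indicator {0<..<e} s * enn2real (h (\<not> c) (riccati_flow C s Y))" for s
    using rde_flow_eq[of s C Y] by (auto simp: indicator_def E)
  have "riccati_M lam C (\<lambda>X. enn2real (h (\<not> c) X)) Y
    = (LINT s|expd. indicator {0<..<e} s * enn2real (h (\<not> c) (riccati_flow C s Y)))"
    unfolding riccati_M_def E by (subst interval_integral_exp_density[OF lam e]) (simp_all add: eq)
  also have "\<dots> = enn2real (\<integral>\<^sup>+ s. ennreal (indicator {0<..<e} s * enn2real (h (\<not> c) (riccati_flow C s Y))) \<partial>expd)"
    by (rule integral_eq_nn_integral) auto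
  also have "(\<integral>\<^sup>+ s. ennreal (indicator {0<..<e} s * enn2real (h (\<not> c) (riccati_flow C s Y))) \<partial>expd)
    = switch_op lam A B h c Y"
    unfolding switch_op_def C_def[symmetric] e_def[symmetric]
  proof (rule nn_integral_cong_AE)
    show "AE s in expd. ennreal (indicator {0<..<e} s * enn2real (h (\<not> c) (riccati_flow C s Y)))
      = of_bool (s < e) * h (\<not> c) (riccati_flow C s Y)"
      using AE_exponential_pos[OF lam] by eventually_elim (auto simp: indicator_def h(2))
  qed
  finally show ?thesis by (simp add: C_def)
qed

text \<open>The exchange of the two coordinates in \<open>block_M\<close> is the negation of the
  flag in \<open>switch_op\<close>; the geometric bound keeps all iterates finite, so nothing is
  lost in passing to real numbers.\<close>

lemma block_M_funpow:
  "(block_M lam A B ^^ n) (\<lambda>Y. vector [riccati_g lam A Y, riccati_g lam B Y])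
    = (\<lambda>Y. vector [enn2real ((switch_op lam A B ^^ n) (switch_mean lam A B) True Y),
                   enn2real ((switch_op lam A B ^^ n) (switch_mean lam A B) False Y)])"
proof (induction n)
  case 0
  then show ?case using riccati_g_eq[of True] riccati_g_eq[of False] by simp
next
  case (Suc n)
  define h where "h = (switch_op lam A B ^^ n) (switch_mean lam A B)"
  have h: "h c \<in> borel_measurable borel" "h c Y < \<top>" for c Y
    using borel_measurable_switch_op_funpow[OF lam]
      le_less_trans[OF funpow_switch_op_le[of n c Y]] by (auto simp: h_def)
  show ?case
    using riccati_M_eq[of h True] riccati_M_eq[of h False] h
    unfolding funpow.simps comp_def Suc.IH by (simp add: block_M_def h_def[symmetric])
qed

section \<open>Geometric tails and convergence in the supremum norm\<close>

definition series_term :: "nat \<Rightarrow> bool \<Rightarrow> real^'k^'m \<Rightarrow> real" where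
  "series_term n c Y = enn2real ((switch_op lam A B ^^ n) (switch_mean lam A B) c Y)"

definition series_sum :: "bool \<Rightarrow> real^'k^'m \<Rightarrow> real" where
  "series_sum c Y = enn2real (\<Sum>n. (switch_op lam A B ^^ n) (switch_mean lam A B) c Y)"

lemma series_term_bounds: "0 \<le> series_term n c Y" "series_term n c Y \<le> rate ^ n * t0"
  using enn2real_mono[OF funpow_switch_op_le[of n c Y]] rate t0_pos by (simp_all add: series_term_def)

text \<open>The tail from \<open>n\<close> on is dominated by the geometric series with terms
  \<open>rate ^ (i + n) * t0\<close>. The bound does not depend on \<open>Y\<close>, which is what
  the genuine supremum norm asks for.\<close>

lemma suminf_switch_op_tail:
  shows "(\<Sum>n. (switch_op lam A B ^^ n) (switch_mean lam A B) c Y) < \<top>"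
    and "\<bar>(\<Sum>i<n. series_term i c Y) - series_sum c Y\<bar> \<le> rate ^ n * (t0 / (1 - rate))"
proof -
  note a0 = series_term_bounds(1) and a_le = series_term_bounds(2)
  have geom: "(\<lambda>i. rate ^ (i + n) * t0) sums (rate ^ n * (t0 / (1 - rate)))" for n
    using sums_mult[OF geometric_sums[of rate], of "rate ^ n * t0"] rate
    by (simp add: power_add mult_ac)
  have "summable (\<lambda>n. rate ^ n * t0)"
    using sums_summable[OF geom[of 0]] by simp
  then have sum_a: "summable (\<lambda>n. series_term n c Y)"
    by (rule summable_comparison_test') (simp add: a0 a_le)
  have "(switch_op lam A B ^^ n) (switch_mean lam A B) c Y = ennreal (series_term n c Y)" for n
    using le_less_trans[OF funpow_switch_op_le[of n c Y] ennreal_less_top] by (simp add: series_term_def)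
  then have eq: "(\<Sum>n. (switch_op lam A B ^^ n) (switch_mean lam A B) c Y) = ennreal (\<Sum>n. series_term n c Y)"
    using suminf_ennreal2[OF a0 sum_a] by simp
  then show "(\<Sum>n. (switch_op lam A B ^^ n) (switch_mean lam A B) c Y) < \<top>" by simp
  have sum_shift: "summable (\<lambda>i. series_term (i + n) c Y)"
    using sum_a by (subst summable_iff_shift)
  have "0 \<le> (\<Sum>n. series_term n c Y)" using sum_a a0 by (rule suminf_nonneg)
  then have "series_sum c Y = (\<Sum>n. series_term n c Y)" by (simp add: series_sum_def eq)
  also have "\<dots> = (\<Sum>i. series_term (i + n) c Y) + (\<Sum>i<n. series_term i c Y)"
    by (rule suminf_split_initial_segment[OF sum_a])
  finally have "(\<Sum>i<n. series_term i c Y) - series_sum c Y = - (\<Sum>i. series_term (i + n) c Y)"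
    by simp
  moreover have "0 \<le> (\<Sum>i. series_term (i + n) c Y)"
    using sum_shift a0 by (rule suminf_nonneg)
  moreover have "(\<Sum>i. series_term (i + n) c Y) \<le> (\<Sum>i. rate ^ (i + n) * t0)"
    using a_le sum_shift sums_summable[OF geom[of n]] by (rule suminf_le)
  ultimately show "\<bar>(\<Sum>i<n. series_term i c Y) - series_sum c Y\<bar> \<le> rate ^ n * (t0 / (1 - rate))"
    using sums_unique[OF geom[of n]] by simp
qed

lemma infnorm_le_abs_add: "infnorm (v :: real^2) \<le> \<bar>v $ 1\<bar> + \<bar>v $ 2\<bar>"
  using order_trans[OF infnorm_le_norm norm_le_l1_cart[of v]] by (simp add: UNIV_2)

lemma Linf_vector_2:
  fixes f g :: "real^'k^'m \<Rightarrow> real"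
  assumes "f \<in> borel_measurable borel" "g \<in> borel_measurable borel"
    and bound: "\<And>Y. \<bar>f Y\<bar> \<le> b" "\<And>Y. \<bar>g Y\<bar> \<le> b"
  shows "(\<lambda>Y. vector [f Y, g Y] :: real^2) \<in> Linf"
  unfolding Linf_def
proof (intro CollectI conjI)
  have "(\<lambda>Y. vector [f Y, g Y] :: real^2) = (\<lambda>Y. f Y *\<^sub>R axis 1 1 + g Y *\<^sub>R axis 2 1)"
    by (simp add: fun_eq_iff vec_eq_iff forall_2 axis_def)
  also have "\<dots> \<in> borel_measurable lborel"
    using assms(1,2) by measurable
  finally show "(\<lambda>Y. vector [f Y, g Y] :: real^2) \<in> borel_measurable lebesgue"
    by (rule measurable_completion)
  have "infnorm (vector [f Y, g Y] :: real^2) \<le> b + b" for Y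
    using infnorm_le_abs_add[of "vector [f Y, g Y]"] bound[of Y] by simp
  then show "bdd_above (range (\<lambda>Y. infnorm (vector [f Y, g Y] :: real^2)))"
    by (intro bdd_aboveI2)
qed

lemma Linf_sums_block_M:
  "Linf_sums
    (\<lambda>n. (block_M lam A B ^^ n) (\<lambda>Y. vector [riccati_g lam A Y, riccati_g lam B Y]))
    (\<lambda>Y. vector [enn2real (\<Sum>n. (switch_op lam A B ^^ n) (switch_mean lam A B) True Y),
                 enn2real (\<Sum>n. (switch_op lam A B ^^ n) (switch_mean lam A B) False Y)])"
  unfolding block_M_funpow series_term_def[symmetric] series_sum_def[symmetric]
proof -
  note [measurable] = borel_measurable_switch_op_funpow[OF lam]
  have am: "series_term n c \<in> borel_measurable borel" and sm: "series_sum c \<in> borel_measurable borel" for n c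
    unfolding series_term_def series_sum_def by measurable
  have "rate ^ n * t0 \<le> t0" for n
    using rate t0_pos by (intro mult_left_le_one_le power_le_one) auto
  then have "\<bar>series_term n c Y\<bar> \<le> t0" for n c Y
    using order_trans[OF series_term_bounds(2)] series_term_bounds(1) by simp
  then have 1: "(\<lambda>Y. vector [series_term n True Y, series_term n False Y] :: real^2) \<in> Linf" for n
    by (intro Linf_vector_2 am)
  have "\<bar>series_sum c Y\<bar> \<le> t0 / (1 - rate)" for c Y
    using suminf_switch_op_tail(2)[where n = 0 and c = c and Y = Y] by simp
  then have 2: "(\<lambda>Y. vector [series_sum True Y, series_sum False Y] :: real^2) \<in> Linf"
    by (intro Linf_vector_2 sm)
  define D where "D = (\<lambda>n Y. (\<Sum>i<n. vector [series_term i True Y, series_term i False Y]) - vector [series_sum True Y, series_sum False Y] :: real^2)"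
  have D: "infnorm (D n Y) \<le> rate ^ n * (t0 / (1 - rate)) + rate ^ n * (t0 / (1 - rate))" for n Y
  proof -
    have "D n Y $ 1 = (\<Sum>i<n. series_term i True Y) - series_sum True Y"
      "D n Y $ 2 = (\<Sum>i<n. series_term i False Y) - series_sum False Y"
      by (simp_all add: D_def)
    then show ?thesis
      using infnorm_le_abs_add[of "D n Y"] suminf_switch_op_tail(2)[where n = n and c = True and Y = Y]
        suminf_switch_op_tail(2)[where n = n and c = False and Y = Y] by linarith
  qed
  have "(\<lambda>n. Linf_norm (D n)) \<longlonglongrightarrow> 0"
  proof (rule tendsto_sandwich[OF always_eventually always_eventually tendsto_const])
    have "(\<lambda>n. rate ^ n * (t0 / (1 - rate)) + rate ^ n * (t0 / (1 - rate))) \<longlonglongrightarrow>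
      0 * (t0 / (1 - rate)) + 0 * (t0 / (1 - rate))"
      using rate by (intro tendsto_intros LIMSEQ_realpow_zero) auto
    then show "(\<lambda>n. rate ^ n * (t0 / (1 - rate)) + rate ^ n * (t0 / (1 - rate))) \<longlonglongrightarrow> 0" by simp
    show "\<forall>n. Linf_norm (D n) \<le> rate ^ n * (t0 / (1 - rate)) + rate ^ n * (t0 / (1 - rate))"
      unfolding Linf_norm_def using D by (auto intro!: cSUP_least)
    \<comment> \<open>A real supremum dominates the values only over a bounded set, so the bound on
      \<open>D\<close> is used once more to compare the norm with the value at one point.\<close>
    show "\<forall>n. 0 \<le> Linf_norm (D n)"
    proof
      fix n
      have "bdd_above (range (\<lambda>Y. infnorm (D n Y)))" using D by (rule bdd_aboveI2)
      then have "infnorm (D n 0) \<le> Linf_norm (D n)" unfolding Linf_norm_def by (rule cSUP_upper2) auto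
      then show "0 \<le> Linf_norm (D n)" using infnorm_pos_le order_trans by blast
    qed
  qed
  then show "Linf_sums (\<lambda>n Y. vector [series_term n True Y, series_term n False Y] :: real^2)
      (\<lambda>Y. vector [series_sum True Y, series_sum False Y])"
    unfolding Linf_sums_def using 1 2 by (simp add: D_def)
qed

end

text \<open>The processes \<open>zA\<close> and \<open>zB\<close> realize the two initial values of
  the switch, driven by the same Poisson process. Measurability and finiteness belong to the claim
  because the means are nonnegative integrals that enter the series through \<open>enn2real\<close>,
  where an infinite value would become \<open>0\<close>.\<close>

theorem theorem3p2:
  fixes A B :: "real^('k::finite + 'm::finite)^('k + 'm)"
    and lam t0 :: real
    and W :: "'w measure"
    and N :: "real \<Rightarrow> 'w \<Rightarrow> nat"
    and zA zB :: "real \<Rightarrow> 'w \<Rightarrow> real"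
  assumes "lam > 0"
    and "poisson_process W lam N"
    and "AE w in W. zA 0 w = 1 \<and> switching_path (\<lambda>t. N t w) (\<lambda>t. zA t w)"
    and "AE w in W. zB 0 w = 0 \<and> switching_path (\<lambda>t. N t w) (\<lambda>t. zB t w)"
    and "t0 > 0"
    and "\<And>Y0 :: real^'k^'m. rde_escape_time A Y0 \<le> ereal t0"
    and "\<And>Y0 :: real^'k^'m. rde_escape_time B Y0 \<le> ereal t0"
  shows "(\<forall>Y0 :: real^'k^'m.
      (\<lambda>w. switched_escape_time A B (\<lambda>t. zA t w) Y0) \<in> borel_measurable (completion W) \<and>
      (\<lambda>w. switched_escape_time A B (\<lambda>t. zB t w) Y0) \<in> borel_measurable (completion W) \<and>
      mean_escape_time W A B zA Y0 < \<infinity> \<and> mean_escape_time W A B zB Y0 < \<infinity>) \<and>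
    Linf_sums
      (\<lambda>n. (block_M lam A B ^^ n) (\<lambda>Y. vector [riccati_g lam A Y, riccati_g lam B Y]))
      (\<lambda>Y. vector [enn2real (mean_escape_time W A B zA Y), enn2real (mean_escape_time W A B zB Y)])"
proof -
  interpret poisson W lam N by standard fact
  have escape: "rde_escape_time (if c then A else B) Y \<le> ereal t0" for c and Y :: "real^'k^'m"
    using assms(6,7) by simp
  interpret bounded_escape A B lam t0
    by standard (fact assms(1), rule escape)
  have fin: "rde_escape_time (if c then A else B) Y < \<infinity>" for c and Y :: "real^'k^'m"
    by (rule le_less_trans[OF escape]) simp
  have zA: "AE w in W. zA 0 w = of_bool True \<and> switching_path (\<lambda>t. N t w) (\<lambda>t. zA t w)"
    and zB: "AE w in W. zB 0 w = of_bool False \<and> switching_path (\<lambda>t. N t w) (\<lambda>t. zB t w)"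
    using assms(3,4) by simp_all
  have meanA: "mean_escape_time W A B zA Y = (\<Sum>n. (switch_op lam A B ^^ n) (switch_mean lam A B) True Y)"
    and meanB: "mean_escape_time W A B zB Y = (\<Sum>n. (switch_op lam A B ^^ n) (switch_mean lam A B) False Y)" for Y
    by (rule mean_escape_time_suminf[OF zA fin], rule mean_escape_time_suminf[OF zB fin])
  show ?thesis
    unfolding meanA meanB
    using switched_escape_time_measurable[OF zA fin] switched_escape_time_measurable[OF zB fin]
      suminf_switch_op_tail(1) Linf_sums_block_M by simp
qed

end
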